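(* Let $G$ be a finite group with exponent $n_1$ and conjugacy class scheme $\mathcal{A}$, and let $\mathcal{L}=\mathbb{Q}(\zeta_{n_1})$. Let $F$ be a subfield of $\mathcal{L}$, let $\tau_k\in\mathrm{Gal}(\mathcal{L}/\mathbb{Q})$ be given by $\tau_k(\zeta_{n_1})=\zeta_{n_1}^k$ for $k\in\mathbb{Z}_{n_1}^*$, and let $Z_F=\{k\in\mathbb{Z}_{n_1}^*:\tau_k\in\mathrm{Gal}(\mathcal{L}/F)\}$. Define $g\sim_F h$ iff $g$ is conjugate to $h^k$ for some $k\in Z_F$. Then the set of matrices in $\mathcal{L}[\mathcal{A}]$ all of whose entries and eigenvalues lie in $F$ equals the $F$-span of the matrices $B_{[g]}=\sum_{h\sim_F g}A_h$, one for each $\sim_F$ equivalence class, and these form a subscheme of $\mathcal{A}$. In particular, a normal Cayley digraph $X(G,C)$ has all its eigenvalues in $F$ if and only if $C$ is a union of equivalence classes of $\sim_F$.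
   Context: For a finite group $G$ of order $n$ (written multiplicatively, identity $1$), $A_g$ is the $n\times n$ permutation matrix indexed by $G$ with $(A_g)_{a,b}=1$ iff $ba^{-1}=g$; for $C\subseteq G$, $A_C=\sum_{g\in C}A_g$, the adjacency matrix of the Cayley digraph $X(G,C)$ (arc $a\to b$ iff $ba^{-1}\in C$). If $K_0,\ldots,K_d$ are the conjugacy classes of $G$ and $A_i=A_{K_i}$, then $\mathcal{A}=\{A_0,\ldots,A_d\}$ is an association scheme, the conjugacy class scheme; $\mathcal{L}[\mathcal{A}]$ is its $\mathcal{L}$-span. $X(G,C)$ is normal if $C$ is a union of conjugacy classes. The exponent $n_1$ is the least positive integer with $g^{n_1}=1$ for all $g$, and $\zeta_{n_1}=e^{2\pi i/n_1}$. A subscheme of $\mathcal{A}$ is an association scheme whose members are sums of members of $\mathcal{A}$ over blocks of a partition of $\mathcal{A}$. *)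

theory Defs
  imports Complex_Main "HOL-Algebra.Group" "HOL-Library.Disjoint_Sets"
begin

definition is_subfield :: "complex set \<Rightarrow> bool" where
  "is_subfield S \<longleftrightarrow> 0 \<in> S \<and> 1 \<in> S \<and> (\<forall>x\<in>S. \<forall>y\<in>S. x + y \<in> S \<and> x * y \<in> S)
     \<and> (\<forall>x\<in>S. - x \<in> S) \<and> (\<forall>x\<in>S. x \<noteq> 0 \<longrightarrow> inverse x \<in> S)"

definition gen_field :: "complex \<Rightarrow> complex set" where
  "gen_field z = \<Inter>{S. is_subfield S \<and> z \<in> S}"

definition zeta :: "nat \<Rightarrow> complex" where
  "zeta n = exp (2 * of_real pi * \<i> / of_nat n)"

definition cyclo_field :: "nat \<Rightarrow> complex set" where
  "cyclo_field n = gen_field (zeta n)"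

definition field_aut :: "complex set \<Rightarrow> (complex \<Rightarrow> complex) \<Rightarrow> bool" where
  "field_aut L \<sigma> \<longleftrightarrow> bij_betw \<sigma> L L \<and>
     (\<forall>x\<in>L. \<forall>y\<in>L. \<sigma> (x + y) = \<sigma> x + \<sigma> y \<and> \<sigma> (x * y) = \<sigma> x * \<sigma> y)"

definition units_mod :: "nat \<Rightarrow> nat set" where
  "units_mod n = {k. k < n \<and> coprime k n}"

definition group_exponent :: "('a, 'b) monoid_scheme \<Rightarrow> nat" where
  "group_exponent G = (LEAST n. n > 0 \<and> (\<forall>g\<in>carrier G. g [^]\<^bsub>G\<^esub> n = \<one>\<^bsub>G\<^esub>))"

definition ZF :: "('a, 'b) monoid_scheme \<Rightarrow> complex set \<Rightarrow> nat set" where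
  "ZF G F = {k \<in> units_mod (group_exponent G).
      \<exists>\<sigma>. field_aut (cyclo_field (group_exponent G)) \<sigma>
         \<and> \<sigma> (zeta (group_exponent G)) = zeta (group_exponent G) ^ k
         \<and> (\<forall>x\<in>F. \<sigma> x = x)}"

definition conjugate :: "('a, 'b) monoid_scheme \<Rightarrow> 'a \<Rightarrow> 'a \<Rightarrow> bool" where
  "conjugate G g h \<longleftrightarrow> (\<exists>x\<in>carrier G. g = x \<otimes>\<^bsub>G\<^esub> h \<otimes>\<^bsub>G\<^esub> inv\<^bsub>G\<^esub> x)"

definition conj_class :: "('a, 'b) monoid_scheme \<Rightarrow> 'a \<Rightarrow> 'a set" where
  "conj_class G g = {x \<otimes>\<^bsub>G\<^esub> g \<otimes>\<^bsub>G\<^esub> inv\<^bsub>G\<^esub> x | x. x \<in> carrier G}"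

definition conj_classes :: "('a, 'b) monoid_scheme \<Rightarrow> 'a set set" where
  "conj_classes G = conj_class G ` carrier G"

definition simF :: "('a, 'b) monoid_scheme \<Rightarrow> complex set \<Rightarrow> 'a \<Rightarrow> 'a \<Rightarrow> bool" where
  "simF G F g h \<longleftrightarrow> g \<in> carrier G \<and> h \<in> carrier G \<and>
     (\<exists>k\<in>ZF G F. conjugate G g (h [^]\<^bsub>G\<^esub> k))"

definition simF_class :: "('a, 'b) monoid_scheme \<Rightarrow> complex set \<Rightarrow> 'a \<Rightarrow> 'a set" where
  "simF_class G F g = {h \<in> carrier G. simF G F h g}"

definition simF_classes :: "('a, 'b) monoid_scheme \<Rightarrow> complex set \<Rightarrow> 'a set set" where
  "simF_classes G F = simF_class G F ` carrier G"

section \<open>Matrices indexed by a finite index set (entries outside are 0)\<close>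

type_synonym 'a mat = "'a \<Rightarrow> 'a \<Rightarrow> complex"

definition perm_mat :: "('a, 'b) monoid_scheme \<Rightarrow> 'a \<Rightarrow> 'a mat" where
  "perm_mat G g = (\<lambda>a b. if a \<in> carrier G \<and> b \<in> carrier G \<and> b \<otimes>\<^bsub>G\<^esub> inv\<^bsub>G\<^esub> a = g then 1 else 0)"

definition set_mat :: "('a, 'b) monoid_scheme \<Rightarrow> 'a set \<Rightarrow> 'a mat" where
  "set_mat G C = (\<lambda>a b. \<Sum>g\<in>C. perm_mat G g a b)"

definition class_scheme :: "('a, 'b) monoid_scheme \<Rightarrow> 'a mat set" where
  "class_scheme G = set_mat G ` conj_classes G"

definition B_mats :: "('a, 'b) monoid_scheme \<Rightarrow> complex set \<Rightarrow> 'a mat set" where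
  "B_mats G F = set_mat G ` simF_classes G F"

definition span_over :: "complex set \<Rightarrow> 'a mat set \<Rightarrow> 'a mat set" where
  "span_over K S = {M. \<exists>c. (\<forall>X\<in>S. c X \<in> K) \<and> M = (\<lambda>a b. \<Sum>X\<in>S. c X * X a b)}"

definition mat_mult :: "'a set \<Rightarrow> 'a mat \<Rightarrow> 'a mat \<Rightarrow> 'a mat" where
  "mat_mult I M N = (\<lambda>a b. if a \<in> I \<and> b \<in> I then \<Sum>c\<in>I. M a c * N c b else 0)"

definition id_mat :: "'a set \<Rightarrow> 'a mat" where
  "id_mat I = (\<lambda>a b. if a \<in> I \<and> b \<in> I \<and> a = b then 1 else 0)"

definition transp_mat :: "'a mat \<Rightarrow> 'a mat" where
  "transp_mat M = (\<lambda>a b. M b a)"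

definition mat_eigenvalue :: "'a set \<Rightarrow> 'a mat \<Rightarrow> complex \<Rightarrow> bool" where
  "mat_eigenvalue I M mu \<longleftrightarrow> (\<exists>v::'a \<Rightarrow> complex. (\<exists>a\<in>I. v a \<noteq> 0) \<and>
      (\<forall>a\<in>I. (\<Sum>b\<in>I. M a b * v b) = mu * v a))"

definition is_assoc_scheme :: "'a set \<Rightarrow> 'a mat set \<Rightarrow> bool" where
  "is_assoc_scheme I S \<longleftrightarrow> finite I \<and> finite S
     \<and> (\<forall>M\<in>S. \<forall>a b. M a b \<in> {0, 1})
     \<and> (\<forall>M\<in>S. \<forall>a b. a \<notin> I \<or> b \<notin> I \<longrightarrow> M a b = 0)
     \<and> (\<forall>M\<in>S. \<exists>a\<in>I. \<exists>b\<in>I. M a b \<noteq> 0)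
     \<and> id_mat I \<in> S
     \<and> (\<forall>a\<in>I. \<forall>b\<in>I. (\<Sum>M\<in>S. M a b) = 1)
     \<and> (\<forall>M\<in>S. transp_mat M \<in> S)
     \<and> (\<forall>M\<in>S. \<forall>N\<in>S. mat_mult I M N \<in> span_over UNIV S)
     \<and> (\<forall>M\<in>S. \<forall>N\<in>S. mat_mult I M N = mat_mult I N M)"

definition is_subscheme :: "'a set \<Rightarrow> 'a mat set \<Rightarrow> 'a mat set \<Rightarrow> bool" where
  "is_subscheme I A S \<longleftrightarrow> is_assoc_scheme I S \<and>
     (\<exists>P. partition_on A P \<and> S = (\<lambda>\<beta>. (\<lambda>a b. \<Sum>M\<in>\<beta>. M a b)) ` P)"

end

theory Submission
  imports "Jordan_Normal_Form.Schur_Decomposition" "HOL-Number_Theory.Residues"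
    "HOL-Algebra.Multiplicative_Group" Defs
begin

hide_const (open) up_ring.coeff up_ring.monom Module.smult

text \<open>
  Write a matrix in the span of the scheme as \<open>M = \<Sum> c g A_g\<close> with a class function \<open>c\<close>, and let
  \<open>n\<close> be the exponent. Each \<open>A_g\<close> has order dividing \<open>n\<close> and commutes with \<open>M\<close>, so splitting along
  the eigenspaces of \<open>A_g\<close> gives \<open>tr (M^m A_g^k) = \<Sum> \<zeta>^(jk) s_(j,m)\<close>, where \<open>s_(j,m)\<close> is a power
  sum of eigenvalues of \<open>M\<close> that does not depend on \<open>k\<close>. On the other hand \<open>tr (M A_g)\<close> is
  \<open>|G| c (g^-1)\<close>.

  If the eigenvalues and entries of \<open>M\<close> lie in \<open>F\<close>, applying \<open>\<tau>_k\<close> to the case \<open>m = 1\<close> shows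
  \<open>c (g^k) = c g\<close>. Conversely, if \<open>c\<close> is \<open>F\<close>-valued and invariant under \<open>g \<mapsto> g^k\<close>, then
  \<open>\<Sum> c g tr (M^m A_g^k) = tr (M^(m+1))\<close> for \<open>k = 1\<close> and for all \<open>k\<close> in \<open>Z_F\<close>. Isolating one nonzero
  eigenvalue \<open>\<mu>\<close> by a polynomial in \<open>M\<close> expresses a multiple of \<open>\<mu>\<close> as an element of the cyclotomic
  field fixed by every \<open>\<tau>_k\<close>, so \<open>\<mu>\<close> lies in \<open>F\<close>.
\<close>

section \<open>Roots of unity\<close>

text \<open>Irreducible characters do not occur. One cyclic subgroup at a time is enough: the
  multiplicities of eigenvalues of \<open>M\<close> inside an eigenspace of \<open>A_g\<close> are
  natural numbers, and those are fixed by every automorphism. In the converse direction the power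
  sums themselves are not known to lie in \<open>F\<close>; the isolating polynomial trades them for
  multiplicities, and its own coefficients, arbitrary complex numbers, disappear in the process. It
  must have no constant term: cutting \<open>M\<close> down to an eigenspace adds spurious zero
  eigenvalues, which only positive powers ignore. This is harmless because 0 lies in
  \<open>F\<close>, so only nonzero eigenvalues have to be isolated. For the subscheme the obstacle
  is closure under products. The map g \<mapsto> g^k is in general no homomorphism, so the
  invariance of a product is not visible from the invariance of its factors; the eigenvalue
  criterion supplies it.\<close>

lemma zeta_power: "zeta n ^ k = cis (2 * pi * real k / real n)"
proof -
  have "zeta n = cis (2 * pi / real n)"
    by (simp add: zeta_def cis_conv_exp mult_ac)
  then show ?thesis by (simp add: DeMoivre mult_ac)
qed

lemma zeta_nonzero [simp]: "zeta n \<noteq> 0"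
  by (simp add: zeta_def)

lemma bij_betw_zeta_powers: "n > 0 \<Longrightarrow> bij_betw (\<lambda>k. zeta n ^ k) {..<n} {z. z ^ n = 1}"
  using bij_betw_roots_unity[of n] by (simp add: zeta_power)

lemma zeta_power_order: "n > 0 \<Longrightarrow> zeta n ^ n = 1"
  by (simp add: zeta_power)

lemma zeta_power_mod: "n > 0 \<Longrightarrow> zeta n ^ (k mod n) = zeta n ^ k"
  by (metis zeta_power_order div_mult_mod_eq mult.commute power_add power_mult power_one
      mult_1)

lemma zeta_power_inj: "i < n \<Longrightarrow> j < n \<Longrightarrow> zeta n ^ i = zeta n ^ j \<Longrightarrow> i = j"
  using bij_betw_zeta_powers[of n] by (auto simp: bij_betw_def inj_on_def)

text \<open>Orthogonality of the characters of a cyclic group of order \<open>n\<close>. It makes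
  the spectral projections of a matrix of order dividing \<open>n\<close> add up to the
  identity.\<close>

lemma sum_zeta_powers:
  assumes "i < n"
  shows "(\<Sum>j<n. inverse (zeta n) ^ (i * j)) = (if i = 0 then of_nat n else 0)"
proof (cases "i = 0")
  case False
  have n: "n > 0" using assms by simp
  define u where "u = inverse (zeta n) ^ i"
  have "zeta n ^ i \<noteq> 1" using zeta_power_inj[of i n 0] assms False by auto
  then have "u \<noteq> 1" by (simp add: u_def power_inverse)
  moreover have "u ^ n = 1"
    by (metis u_def power_inverse power_mult mult.commute zeta_power_order[OF n] power_one inverse_1)
  ultimately have "(\<Sum>j<n. u ^ j) = 0" by (simp add: geometric_sum)
  then show ?thesis using False by (simp add: u_def power_mult)
qed simp

section \<open>The fixed field of the automorphisms of a cyclotomic field over F\<close>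

context
  fixes F :: "complex set"
  assumes F: "is_subfield F"
begin

lemma subfield_0 [simp]: "0 \<in> F" and subfield_1 [simp]: "1 \<in> F"
  and subfield_add: "x \<in> F \<Longrightarrow> y \<in> F \<Longrightarrow> x + y \<in> F"
  and subfield_mult: "x \<in> F \<Longrightarrow> y \<in> F \<Longrightarrow> x * y \<in> F"
  and subfield_uminus: "x \<in> F \<Longrightarrow> - x \<in> F"
  and subfield_inverse: "x \<in> F \<Longrightarrow> inverse x \<in> F"
  using F by (auto simp: is_subfield_def)

lemma subfield_diff: "x \<in> F \<Longrightarrow> y \<in> F \<Longrightarrow> x - y \<in> F"
  using subfield_add[of x "- y"] subfield_uminus[of y] by simp

lemma subfield_divide: "x \<in> F \<Longrightarrow> y \<in> F \<Longrightarrow> x / y \<in> F"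
  using subfield_mult[of x "inverse y"] subfield_inverse[of y] by (simp add: divide_inverse)

lemma subfield_sum: "(\<And>i. i \<in> A \<Longrightarrow> f i \<in> F) \<Longrightarrow> sum f A \<in> F"
  by (induction A rule: infinite_finite_induct) (auto intro: subfield_add)

lemma subfield_sum_list: "(\<And>x. x \<in> set xs \<Longrightarrow> f x \<in> F) \<Longrightarrow> (\<Sum>x\<leftarrow>xs. f x) \<in> F"
  by (induction xs) (auto intro: subfield_add)

lemma subfield_power: "x \<in> F \<Longrightarrow> x ^ m \<in> F"
  by (induction m) (auto intro: subfield_mult)

lemma subfield_of_nat: "of_nat m \<in> F"
  by (induction m) (auto intro: subfield_add)

end

section \<open>Division and minimal polynomials over \<open>F\<close>\<close>

definition polys_over :: "complex set \<Rightarrow> complex poly set" where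
  "polys_over F = {p. \<forall>i. coeff p i \<in> F}"

context
  fixes F :: "complex set"
  assumes F: "is_subfield F"
begin

lemma polys_over_0 [simp]: "0 \<in> polys_over F"
  using F by (simp add: polys_over_def subfield_0)

lemma polys_over_monom: "c \<in> F \<Longrightarrow> monom c m \<in> polys_over F"
  using F by (simp add: polys_over_def subfield_0)

lemma polys_over_1 [simp]: "1 \<in> polys_over F"
  using polys_over_monom[of 1 0] F by (simp add: subfield_1 flip: one_poly_eq_simps(1))

lemma polys_over_add: "p \<in> polys_over F \<Longrightarrow> q \<in> polys_over F \<Longrightarrow> p + q \<in> polys_over F"
  using F by (simp add: polys_over_def subfield_add)

lemma polys_over_diff: "p \<in> polys_over F \<Longrightarrow> q \<in> polys_over F \<Longrightarrow> p - q \<in> polys_over F"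
  using F by (simp add: polys_over_def subfield_diff)

lemma polys_over_uminus: "p \<in> polys_over F \<Longrightarrow> - p \<in> polys_over F"
  using F by (simp add: polys_over_def subfield_uminus)

lemma polys_over_mult: "p \<in> polys_over F \<Longrightarrow> q \<in> polys_over F \<Longrightarrow> p * q \<in> polys_over F"
  using F by (simp add: polys_over_def coeff_mult subfield_sum subfield_mult)

lemma polys_over_smult: "c \<in> F \<Longrightarrow> p \<in> polys_over F \<Longrightarrow> smult c p \<in> polys_over F"
  using F by (simp add: polys_over_def subfield_mult)

lemma polys_over_sum: "(\<And>i. i \<in> A \<Longrightarrow> f i \<in> polys_over F) \<Longrightarrow> sum f A \<in> polys_over F"
  by (induction A rule: infinite_finite_induct) (auto intro: polys_over_add)

text \<open>Long division, carried out step by step so that membership of all coefficients in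
  \<open>F\<close> can be followed. Polynomials stay complex throughout; being defined over
  \<open>F\<close> is a side condition, so roots and divisibility over the complex numbers remain
  available.\<close>

lemma polys_over_division:
  assumes s: "s \<in> polys_over F" "s \<noteq> 0" and "p \<in> polys_over F"
  shows "\<exists>t\<in>polys_over F. \<exists>r\<in>polys_over F. p = s * t + r \<and> (r = 0 \<or> degree r < degree s)"
  using assms(3)
proof (induction "degree p" arbitrary: p rule: less_induct)
  case less
  show ?case
  proof (cases "degree p < degree s")
    case True
    then show ?thesis using less.prems by (intro bexI[of _ 0] bexI[of _ p]) auto
  next
    case False
    define q where "q = monom (lead_coeff p / lead_coeff s) (degree p - degree s)"
    define p' where "p' = p - s * q"
    have q: "q \<in> polys_over F" unfolding q_def
      using less.prems s F by (intro polys_over_monom) (auto simp: polys_over_def intro: subfield_divide)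
    have p': "p' \<in> polys_over F" unfolding p'_def
      using less.prems s q by (intro polys_over_diff polys_over_mult)
    have "degree q \<le> degree p - degree s" by (simp add: q_def degree_monom_le)
    then have "degree (s * q) \<le> degree p" using degree_mult_le[of s q] False by linarith
    then have "degree p' \<le> degree p" unfolding p'_def by (intro degree_diff_le) auto
    moreover have "coeff p' (degree p) = 0"
    proof -
      have "coeff (s * q) (degree p) = lead_coeff s * (lead_coeff p / lead_coeff s)"
        using False by (simp add: q_def coeff_monom_mult mult.commute[of s])
      then show ?thesis using s by (simp add: p'_def)
    qed
    ultimately have "p' = 0 \<or> degree p' < degree p" by (rule eq_zero_or_degree_less)
    then show ?thesis
    proof
      assume "p' = 0"
      then show ?thesis using q by (intro bexI[of _ q] bexI[of _ 0]) (auto simp: p'_def)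
    next
      assume "degree p' < degree p"
      from less.hyps[OF this p'] obtain t r where
        tr: "t \<in> polys_over F" "r \<in> polys_over F" "p' = s * t + r" "r = 0 \<or> degree r < degree s"
        by blast
      have "p = s * (t + q) + r" using tr(3) by (simp add: p'_def algebra_simps)
      then show ?thesis using tr q by (intro bexI[of _ "t + q"] bexI[of _ r] conjI)
          (auto intro: polys_over_add)
    qed
  qed
qed

end

text \<open>Minimality of the degree takes the place of irreducibility, and no normalisation is
  imposed: over a subfield, two such polynomials differ by a nonzero constant factor.\<close>

definition is_min_poly :: "complex set \<Rightarrow> complex \<Rightarrow> complex poly \<Rightarrow> bool" where
  "is_min_poly F z p \<longleftrightarrow> p \<in> polys_over F \<and> p \<noteq> 0 \<and> poly p z = 0 \<and>
     (\<forall>q\<in>polys_over F. q \<noteq> 0 \<and> poly q z = 0 \<longrightarrow> degree p \<le> degree q)"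

lemma min_poly_exists:
  assumes "q \<in> polys_over F" "q \<noteq> 0" "poly q z = 0"
  shows "\<exists>p. is_min_poly F z p"
  using ex_has_least_nat[of "\<lambda>q. q \<in> polys_over F \<and> q \<noteq> 0 \<and> poly q z = 0" q degree] assms
  by (auto simp: is_min_poly_def)

lemma min_poly_dvd:
  assumes F: "is_subfield F" and p: "is_min_poly F z p" and q: "q \<in> polys_over F" "poly q z = 0"
  shows "p dvd q"
proof -
  from polys_over_division[OF F _ _ q(1), of p] p obtain t r where
    tr: "t \<in> polys_over F" "r \<in> polys_over F" "q = p * t + r" "r = 0 \<or> degree r < degree p"
    by (auto simp: is_min_poly_def)
  have "poly r z = 0" using tr(3) q p by (simp add: is_min_poly_def)
  then have "r = 0" using tr p by (auto simp: is_min_poly_def)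
  then show ?thesis using tr by simp
qed

lemma min_poly_reduce:
  assumes F: "is_subfield F" and p: "is_min_poly F z p" and q: "q \<in> polys_over F"
  shows "\<exists>r\<in>polys_over F. poly r z = poly q z \<and> (r = 0 \<or> degree r < degree p)"
proof -
  from polys_over_division[OF F _ _ q(1), of p] p obtain t r where
    "t \<in> polys_over F" "r \<in> polys_over F" "q = p * t + r" "r = 0 \<or> degree r < degree p"
    by (auto simp: is_min_poly_def)
  then show ?thesis using p by (intro bexI[of _ r]) (auto simp: is_min_poly_def)
qed

text \<open>The polynomials over \<open>F\<close> whose value at \<open>z\<close> is
  \<open>poly q z\<close> times a value of another such polynomial form an ideal. A nonzero member
  \<open>s\<close> of least degree divides \<open>p\<close>; since its degree is below that of
  \<open>p\<close>, the cofactor vanishes at \<open>z\<close>, so by minimality it has full degree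
  and \<open>s\<close> is a nonzero constant. Dividing by that constant gives the inverse.\<close>

lemma min_poly_inverse:
  assumes F: "is_subfield F" and p: "is_min_poly F z p" and q: "q \<in> polys_over F" "poly q z \<noteq> 0"
  shows "\<exists>t\<in>polys_over F. poly t z = inverse (poly q z)"
proof -
  define x where "x = poly q z"
  \<comment> \<open>Reducing modulo \<open>p\<close> puts a nonzero member of degree below
    \<open>degree p\<close> into the ideal, which bounds the least degree.\<close>
  obtain r where r: "r \<in> polys_over F" "poly r z = x" "r = 0 \<or> degree r < degree p"
    using min_poly_reduce[OF F p q(1)] by (auto simp: x_def)
  have r0: "r \<noteq> 0" using r q by (auto simp: x_def)
  let ?J = "\<lambda>s. s \<in> polys_over F \<and> s \<noteq> 0 \<and> (\<exists>t\<in>polys_over F. poly s z = x * poly t z)"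
  have rJ: "?J r" using r r0 F by (auto intro!: bexI[of _ 1])
  obtain s where s: "?J s" "\<And>y. ?J y \<Longrightarrow> degree s \<le> degree y"
    using ex_has_least_nat[of ?J r degree, OF rJ] by blast
  then obtain ts where ts: "ts \<in> polys_over F" "poly s z = x * poly ts z" by blast
  have sp: "degree s < degree p" using s(2)[OF rJ] r r0 by auto
  obtain t r' where tr: "t \<in> polys_over F" "r' \<in> polys_over F" "p = s * t + r'"
    "r' = 0 \<or> degree r' < degree s"
    using polys_over_division[OF F _ _, of s p] s p by (auto simp: is_min_poly_def)
  have "r' = 0"
  proof (rule ccontr)
    assume "r' \<noteq> 0"
    have "poly r' z = x * poly (- (ts * t)) z"
      using tr(3) p ts by (simp add: is_min_poly_def) (metis add_eq_0_iff mult.assoc)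
    then have "?J r'"
      using \<open>r' \<noteq> 0\<close> tr ts F by (blast intro: polys_over_mult polys_over_uminus)
    then show False using s(2)[of r'] tr(4) \<open>r' \<noteq> 0\<close> by simp
  qed
  then have pst: "p = s * t" using tr by simp
  have "poly s z \<noteq> 0" using s sp p by (auto simp: is_min_poly_def)
  then have "poly t z = 0" using pst p by (auto simp: is_min_poly_def)
  moreover have "t \<noteq> 0" using pst p by (auto simp: is_min_poly_def)
  ultimately have "degree p \<le> degree t" using tr p by (auto simp: is_min_poly_def)
  moreover have "degree p = degree s + degree t"
    using pst s \<open>t \<noteq> 0\<close> by (simp add: degree_mult_eq)
  ultimately have "degree s = 0" by simp
  then obtain c where c: "s = [:c:]" by (rule degree_eq_zeroE)
  then have "c \<in> F" "c \<noteq> 0" using s(1) by (auto simp: polys_over_def dest: spec[of _ 0])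
  have "c = x * poly ts z" using ts c by simp
  then have "poly (smult (inverse c) ts) z = inverse x"
    using \<open>c \<noteq> 0\<close> by (auto simp: field_simps)
  moreover have "smult (inverse c) ts \<in> polys_over F"
    using ts \<open>c \<in> F\<close> F by (auto intro: polys_over_smult subfield_inverse)
  ultimately show ?thesis by (intro bexI[of _ "smult (inverse c) ts"]) (simp_all add: x_def)
qed

lemma is_subfield_simple_extension:
  assumes F: "is_subfield F" and p: "is_min_poly F z p"
  shows "is_subfield {poly q z | q. q \<in> polys_over F}" (is "is_subfield ?E")
  unfolding is_subfield_def
proof (intro conjI ballI impI)
  show "0 \<in> ?E" using polys_over_0[OF F] by force
  show "1 \<in> ?E" using polys_over_1[OF F] by force
next
  fix x y assume "x \<in> ?E" "y \<in> ?E"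
  then obtain q r where "q \<in> polys_over F" "r \<in> polys_over F" "x = poly q z" "y = poly r z" by auto
  then show "x + y \<in> ?E" "x * y \<in> ?E"
    using polys_over_add[OF F, of q r] polys_over_mult[OF F, of q r]
    by (auto intro: exI[of _ "q + r"] exI[of _ "q * r"])
next
  fix x assume "x \<in> ?E"
  then show "- x \<in> ?E"
    using polys_over_uminus[OF F] by (force simp flip: poly_minus)
next
  fix x assume "x \<in> ?E" "x \<noteq> 0"
  then show "inverse x \<in> ?E" using min_poly_inverse[OF F p] by force
qed

lemma is_subfield_gen_field: "is_subfield (gen_field z)"
  unfolding gen_field_def is_subfield_def by auto

text \<open>The values at \<open>z\<close> already form a field by \<open>min_poly_inverse\<close>.
  Hence an automorphism over the intermediate field \<open>F\<close> can be prescribed by evaluating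
  the same polynomials at another root.\<close>

lemma gen_field_eq_simple_extension:
  assumes F: "is_subfield F" "F \<subseteq> gen_field z" and p: "is_min_poly F z p"
  shows "gen_field z = {poly q z | q. q \<in> polys_over F}"
proof
  have "z = poly (monom 1 1) z" by (simp add: poly_monom)
  then have "z \<in> {poly q z | q. q \<in> polys_over F}"
    using polys_over_monom[OF F(1) subfield_1[OF F(1)], of 1] by blast
  then show "gen_field z \<subseteq> {poly q z | q. q \<in> polys_over F}"
    using is_subfield_simple_extension[OF F(1) p] unfolding gen_field_def by blast
next
  have E: "is_subfield (gen_field z)" "z \<in> gen_field z"
    using is_subfield_gen_field by (auto simp: gen_field_def)
  have "poly q z \<in> gen_field z" if "q \<in> polys_over F" for q
    unfolding poly_altdef using that F(2) E
    by (intro subfield_sum subfield_mult subfield_power) (auto simp: polys_over_def)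
  then show "{poly q z | q. q \<in> polys_over F} \<subseteq> gen_field z" by blast
qed

text \<open>The roots of the minimal polynomial of \<open>\<zeta>\<close> over \<open>F\<close> are powers of \<open>\<zeta>\<close>, and evaluation
  at any of them induces an automorphism.\<close>

lemma automorphism_of_root:
  assumes F: "is_subfield F" "F \<subseteq> cyclo_field n" and n: "n > 0"
    and p: "is_min_poly F (zeta n) p" and y: "poly p y = 0"
  shows "\<exists>\<sigma> k. k \<in> units_mod n \<and> field_aut (cyclo_field n) \<sigma> \<and> \<sigma> (zeta n) = zeta n ^ k \<and>
           (\<forall>x\<in>F. \<sigma> x = x) \<and> (\<forall>q\<in>polys_over F. \<sigma> (poly q (zeta n)) = poly q y)"
proof -
  define z L where "z = zeta n" and "L = cyclo_field n"
  have L: "L = {poly q z | q. q \<in> polys_over F}"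
    using gen_field_eq_simple_extension[of F "zeta n" p] F p by (simp add: L_def z_def cyclo_field_def)
  have Lsub: "is_subfield L"
    by (simp add: L_def cyclo_field_def is_subfield_gen_field)
  define \<sigma> where "\<sigma> x = poly (SOME q. q \<in> polys_over F \<and> poly q z = x) y" for x
  have \<sigma>: "\<sigma> (poly q z) = poly q y" if q: "q \<in> polys_over F" for q
  proof -
    define q' where "q' = (SOME q'. q' \<in> polys_over F \<and> poly q' z = poly q z)"
    have "q' \<in> polys_over F \<and> poly q' z = poly q z"
      unfolding q'_def by (rule someI[of _ q]) (use q in simp)
    then have "p dvd q' - q"
      using p q F by (intro min_poly_dvd[of F z]) (auto simp: z_def intro: polys_over_diff)
    then have "poly (q' - q) y = 0" using y by (metis dvdE mult_zero_left poly_mult)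
    then show ?thesis by (simp add: \<sigma>_def q'_def)
  qed
  have add: "\<sigma> (a + b) = \<sigma> a + \<sigma> b" and mult: "\<sigma> (a * b) = \<sigma> a * \<sigma> b" if ab: "a \<in> L" "b \<in> L" for a b
  proof -
    obtain q r where qr: "q \<in> polys_over F" "r \<in> polys_over F" "a = poly q z" "b = poly r z"
      using ab L by auto
    show "\<sigma> (a + b) = \<sigma> a + \<sigma> b"
      using \<sigma>[OF polys_over_add[OF F(1) qr(1,2)]] qr \<sigma> by simp
    show "\<sigma> (a * b) = \<sigma> a * \<sigma> b"
      using \<sigma>[OF polys_over_mult[OF F(1) qr(1,2)]] qr \<sigma> by simp
  qed
  have fixF: "\<sigma> c = c" if "c \<in> F" for c
    using \<sigma>[OF polys_over_monom[OF F(1) that, of 0]] by (simp add: poly_monom)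
  have zpow: "\<sigma> (z ^ m) = y ^ m" for m
    using \<sigma>[OF polys_over_monom[OF F(1) subfield_1[OF F(1)], of m]] by (simp add: poly_monom)
  have zL: "z ^ m \<in> L" for m
    using polys_over_monom[OF F(1) subfield_1[OF F(1)], of m] L by (force simp: poly_monom)
  have nz: "\<sigma> d \<noteq> 0" if "d \<in> L" "d \<noteq> 0" for d
  proof
    assume "\<sigma> d = 0"
    moreover have "inverse d \<in> L" using Lsub that by (simp add: subfield_inverse)
    ultimately have "\<sigma> (d * inverse d) = 0" using mult[of d "inverse d"] that by (simp only: mult_zero_left)
    then show False using that fixF[OF subfield_1[OF F(1)]] by simp
  qed
  have inj: "inj_on \<sigma> L"
  proof (rule inj_onI)
    fix a b assume ab: "a \<in> L" "b \<in> L" "\<sigma> a = \<sigma> b"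
    then have "a - b \<in> L" using Lsub by (simp add: subfield_diff)
    then have "\<sigma> a = \<sigma> (a - b) + \<sigma> b" using add[of "a - b" b] ab by simp
    then show "a = b" using ab nz[OF \<open>a - b \<in> L\<close>] by auto
  qed
  have yn: "y ^ n = 1"
    using zpow[of n] zeta_power_order[OF n] fixF[OF subfield_1[OF F(1)]] by (simp add: z_def)
  \<comment> \<open>\<open>\<sigma>\<close> is injective and sends \<open>z ^ i\<close> to
    \<open>y ^ i\<close>, so \<open>y\<close> is again a primitive root of unity. This gives the
    coprimality of the exponent \<open>k\<close>, and also \<open>z = y ^ l\<close>, on which
    surjectivity rests.\<close>
  have yinj: "inj_on (\<lambda>i. y ^ i) {..<n}"
  proof (rule inj_onI)
    fix i j assume ij: "i \<in> {..<n}" "j \<in> {..<n}" "y ^ i = y ^ j"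
    then have "z ^ i = z ^ j" using inj zL zpow by (metis inj_onD)
    then show "i = j" using ij zeta_power_inj by (auto simp: z_def)
  qed
  have "(\<lambda>i. y ^ i) ` {..<n} = {x. x ^ n = 1}"
  proof (rule card_subset_eq)
    show "finite {x::complex. x ^ n = 1}" using n by (intro finite_roots_unity) auto
    have "(y ^ i) ^ n = 1" for i by (metis yn mult.commute power_mult power_one)
    then show "(\<lambda>i. y ^ i) ` {..<n} \<subseteq> {x. x ^ n = 1}" by auto
    show "card ((\<lambda>i. y ^ i) ` {..<n}) = card {x::complex. x ^ n = 1}"
      using yinj n by (simp add: card_image card_roots_unity_eq)
  qed
  moreover have "z \<in> {x. x ^ n = 1}" using zeta_power_order[OF n] by (simp add: z_def)
  ultimately obtain l where l: "z = y ^ l" by (metis (no_types, lifting) imageE)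
  obtain k where k: "k < n" "y = z ^ k"
  proof -
    have "y \<in> (\<lambda>k. zeta n ^ k) ` {..<n}"
      using bij_betw_zeta_powers[OF n] yn by (simp add: bij_betw_def)
    then show ?thesis using that by (auto simp: z_def)
  qed
  have "coprime k n"
  proof (rule ccontr)
    assume "\<not> coprime k n"
    define d where "d = gcd k n"
    have d: "d > 1" "d dvd k" "d dvd n"
      using n \<open>\<not> coprime k n\<close> by (auto simp: d_def coprime_iff_gcd_eq_1 nat_neq_iff)
    then obtain k' n' where kn: "k = d * k'" "n = d * n'" by (auto elim!: dvdE)
    have "y ^ n' = (z ^ n) ^ k'" by (simp add: k kn mult_ac flip: power_mult)
    then have "y ^ n' = y ^ 0" using zeta_power_order[OF n] by (simp add: z_def)
    moreover have "0 < n'" "n' < n" using kn d n by auto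
    ultimately show False using inj_onD[OF yinj, of n' 0] by auto
  qed
  have surj: "\<sigma> ` L = L"
  proof
    show "\<sigma> ` L \<subseteq> L"
    proof
      fix v assume "v \<in> \<sigma> ` L"
      then obtain q where q: "q \<in> polys_over F" "v = poly q y" using L \<sigma> by auto
      show "v \<in> L" unfolding q(2) k(2) poly_altdef
        using q(1) F(2) zL Lsub
        by (intro subfield_sum subfield_mult subfield_power[of _ "z ^ k"])
          (auto simp: polys_over_def L_def)
    qed
    show "L \<subseteq> \<sigma> ` L"
    proof
      fix v assume "v \<in> L"
      then obtain q where q: "q \<in> polys_over F" "v = poly q z" using L by auto
      \<comment> \<open>This is \<open>q\<close> composed with the \<open>l\<close>-th power: its
        value at \<open>y\<close> is the value of \<open>q\<close> at
        \<open>y ^ l = z\<close>.\<close>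
      define q' where "q' = (\<Sum>i\<le>degree q. monom (coeff q i) (l * i))"
      have q': "q' \<in> polys_over F" unfolding q'_def
        using q F(1) by (intro polys_over_sum polys_over_monom) (auto simp: polys_over_def)
      have "poly q' y = v"
        unfolding q(2) l poly_altdef[of q] q'_def poly_sum poly_monom by (simp add: power_mult)
      then show "v \<in> \<sigma> ` L" using \<sigma>[OF q'] q' L by force
    qed
  qed
  show ?thesis
  proof (intro exI[of _ \<sigma>] exI[of _ k] conjI ballI)
    show "k \<in> units_mod n" using k \<open>coprime k n\<close> by (simp add: units_mod_def)
    show "field_aut (cyclo_field n) \<sigma>"
      using inj surj add mult by (auto simp: field_aut_def bij_betw_def L_def)
    show "\<sigma> (zeta n) = zeta n ^ k" using zpow[of 1] k by (simp add: z_def)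
  qed (use fixF \<sigma> in \<open>auto simp: z_def\<close>)
qed

text \<open>Separability by counting: the \<open>n\<close> distinct roots of unity are shared out
  between \<open>p\<close> and its cofactor, and the cofactor takes at most as many as its
  degree.\<close>

lemma card_roots_dvd_roots_unity:
  fixes p :: "complex poly"
  assumes n: "n > 0" and p: "p dvd monom 1 n - 1"
  shows "degree p \<le> card {y. poly p y = 0}"
proof -
  obtain t where t: "monom 1 n - 1 = p * t" using p by (auto elim: dvdE)
  have deg: "degree (monom 1 n - 1 :: complex poly) = n"
    using degree_add_eq_left[of "- 1" "monom (1::complex) n"] n by (simp add: degree_monom_eq)
  then have nz: "p \<noteq> 0" "t \<noteq> 0" using t n by auto
  have "{y. y ^ n = 1} = {y. poly (p * t) y = 0}"
    by (simp add: poly_monom flip: t)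
  also have "\<dots> = {y. poly p y = 0} \<union> {y. poly t y = 0}" by auto
  finally have "n \<le> card {y. poly p y = 0} + card {y. poly t y = 0}"
    using card_Un_le card_roots_unity_eq[OF n] by metis
  also have "card {y. poly t y = 0} \<le> degree t" using nz by (intro card_poly_roots_bound)
  also have "degree p + degree t = n" using deg t nz by (simp add: degree_mult_eq)
  ultimately show ?thesis by linarith
qed

text \<open>Write \<open>x\<close> as the value at \<open>zeta n\<close> of a polynomial
  \<open>q\<close> that is zero or of degree below that of the minimal polynomial \<open>p\<close>.
  Each root of \<open>p\<close> comes from an automorphism fixing \<open>x\<close>, so
  \<open>q - [:x:]\<close> vanishes at \<open>degree p\<close> distinct points and must be zero.
  Thus \<open>x\<close> is a coefficient of \<open>q\<close>.\<close>

lemma fixed_field: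
  assumes F: "is_subfield F" "F \<subseteq> cyclo_field n" and n: "n > 0" and x: "x \<in> cyclo_field n"
    and fx: "\<And>\<sigma> k. k \<in> units_mod n \<Longrightarrow> field_aut (cyclo_field n) \<sigma> \<Longrightarrow> \<sigma> (zeta n) = zeta n ^ k \<Longrightarrow>
           (\<And>c. c \<in> F \<Longrightarrow> \<sigma> c = c) \<Longrightarrow> \<sigma> x = x"
  shows "x \<in> F"
proof -
  let ?X = "monom 1 n - 1 :: complex poly"
  have "coeff ?X n = 1" using n by simp
  then have "?X \<noteq> 0" by (metis coeff_0 zero_neq_one)
  then have X: "?X \<in> polys_over F" "?X \<noteq> 0" "poly ?X (zeta n) = 0"
    using F n zeta_power_order[OF n]
    by (auto simp: poly_monom intro!: polys_over_diff polys_over_monom subfield_1 polys_over_1)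
  obtain p where p: "is_min_poly F (zeta n) p"
    using min_poly_exists[OF X] by blast
  obtain q0 where "q0 \<in> polys_over F" "x = poly q0 (zeta n)"
    using x gen_field_eq_simple_extension[of F "zeta n" p] F p by (auto simp: cyclo_field_def)
  then obtain q where q: "q \<in> polys_over F" "x = poly q (zeta n)" "q = 0 \<or> degree q < degree p"
    using min_poly_reduce[OF F(1) p, of q0] by auto
  have root: "poly (q - [:x:]) y = 0" if y: "poly p y = 0" for y
  proof -
    obtain \<sigma> k where \<sigma>: "k \<in> units_mod n" "field_aut (cyclo_field n) \<sigma>" "\<sigma> (zeta n) = zeta n ^ k"
      "\<forall>c\<in>F. \<sigma> c = c" "\<forall>q\<in>polys_over F. \<sigma> (poly q (zeta n)) = poly q y"
      using automorphism_of_root[OF F n p y] by blast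
    have "\<sigma> x = x" using \<sigma> by (intro fx) auto
    then show ?thesis using \<sigma>(5) q by auto
  qed
  have "p dvd ?X" by (rule min_poly_dvd[OF F(1) p X(1,3)])
  then have card: "degree p \<le> card {y. poly p y = 0}" by (rule card_roots_dvd_roots_unity[OF n])
  have "q - [:x:] = 0"
  proof (rule ccontr)
    assume nz: "q - [:x:] \<noteq> 0"
    then have "q \<noteq> 0" using q by auto
    have "card {y. poly p y = 0} \<le> card {y. poly (q - [:x:]) y = 0}"
      using root nz by (intro card_mono poly_roots_finite) auto
    also have "\<dots> \<le> degree (q - [:x:])" using nz by (rule card_poly_roots_bound)
    also have "\<dots> \<le> degree q" by (rule degree_diff_le) auto
    finally show False using card q(3) \<open>q \<noteq> 0\<close> by simp
  qed
  then have "coeff q 0 = x" by simp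
  then show ?thesis using q(1) by (auto simp: polys_over_def)
qed

section \<open>Traces of matrices over a finite index set\<close>

primrec mat_pow :: "'a set \<Rightarrow> ('a \<Rightarrow> 'a \<Rightarrow> complex) \<Rightarrow> nat \<Rightarrow> 'a \<Rightarrow> 'a \<Rightarrow> complex" where
  "mat_pow I M 0 = id_mat I"
| "mat_pow I M (Suc m) = mat_mult I (mat_pow I M m) M"

definition mat_trace :: "'a set \<Rightarrow> ('a \<Rightarrow> 'a \<Rightarrow> complex) \<Rightarrow> complex" where
  "mat_trace I M = (\<Sum>a\<in>I. M a a)"

lemma trace_mult_commute_jnf:
  fixes A B :: "complex Matrix.mat"
  assumes "A \<in> carrier_mat n n" "B \<in> carrier_mat n n"
  shows "(\<Sum>i<n. (A * B) $$ (i,i)) = (\<Sum>i<n. (B * A) $$ (i,i))"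
proof -
  have "(\<Sum>i<n. (A * B) $$ (i,i)) = (\<Sum>i<n. \<Sum>j<n. A $$ (i,j) * B $$ (j,i))"
    using assms by (auto intro!: sum.cong simp: scalar_prod_def lessThan_atLeast0)
  also have "\<dots> = (\<Sum>j<n. \<Sum>i<n. A $$ (i,j) * B $$ (j,i))"
    by (rule sum.swap)
  also have "\<dots> = (\<Sum>i<n. (B * A) $$ (i,i))"
    using assms by (auto intro!: sum.cong simp: scalar_prod_def lessThan_atLeast0)
  finally show ?thesis .
qed

lemma upper_triangular_pow:
  fixes B :: "complex Matrix.mat"
  assumes B: "B \<in> carrier_mat n n" "upper_triangular B"
  shows "upper_triangular (B ^\<^sub>m k) \<and> (\<forall>i<n. (B ^\<^sub>m k) $$ (i,i) = (B $$ (i,i)) ^ k)"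
proof (induction k)
  case 0
  show ?case using B(1) by auto
next
  case (Suc k)
  let ?C = "B ^\<^sub>m k"
  have C: "?C \<in> carrier_mat n n" using B(1) by auto
  have ent: "(?C * B) $$ (i,j) = (\<Sum>l<n. ?C $$ (i,l) * B $$ (l,j))" if "i < n" "j < n" for i j
    using that B(1) C by (auto intro!: sum.cong simp: scalar_prod_def lessThan_atLeast0)
  have low: "?C $$ (i,l) = 0" if "l < i" "i < n" for i l
    using Suc C that by auto
  have lowB: "B $$ (i,l) = 0" if "l < i" "i < n" for i l
    using B that by auto
  have "(?C * B) $$ (i,j) = 0" if "j < i" "i < n" for i j
  proof -
    \<comment> \<open>Either \<open>l < i\<close> and the first factor lies below the diagonal, or
      \<open>j < i \<le> l\<close> and the second one does.\<close>
    have "?C $$ (i,l) * B $$ (l,j) = 0" if "l < n" for l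
      using low[of l i] lowB[of j l] that \<open>j < i\<close> \<open>i < n\<close> by (cases "l < i") auto
    then have "(\<Sum>l<n. ?C $$ (i,l) * B $$ (l,j)) = 0" by (intro sum.neutral) blast
    then show ?thesis using ent[of i j] that by simp
  qed
  moreover have "(?C * B) $$ (i,i) = (B $$ (i,i)) ^ Suc k" if "i < n" for i
  proof -
    have "?C $$ (i,l) * B $$ (l,i) = (if l = i then (B $$ (i,i)) ^ Suc k else 0)" if "l < n" for l
      using low[of l i] lowB[of i l] that \<open>i < n\<close> Suc by (cases l i rule: linorder_cases) auto
    then show ?thesis using ent[of i i] that by simp
  qed
  ultimately show ?case using B(1) C by auto
qed

text \<open>Schur triangularisation: the diagonal of the triangular form lists the roots of the
  characteristic polynomial, and the trace of a power is invariant under similarity. The list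
  \<open>es\<close> carries algebraic multiplicities, so non-diagonalisable matrices are
  covered.\<close>

lemma trace_powers_jnf:
  fixes A :: "complex Matrix.mat"
  assumes A: "A \<in> carrier_mat n n"
  shows "\<exists>es. set es = {x. eigenvalue A x} \<and>
           (\<forall>m. (\<Sum>i<n. (A ^\<^sub>m m) $$ (i,i)) = (\<Sum>x\<leftarrow>es. x ^ m))"
proof -
  from char_poly_factorized[OF A] obtain es where
    es: "char_poly A = (\<Prod>a\<leftarrow>es. [:- a, 1:])" by blast
  obtain B P Q where "schur_decomposition A es = (B,P,Q)" by (metis prod_cases3)
  from schur_decomposition[OF A es this]
  have sim: "similar_mat_wit A B P Q" and ut: "upper_triangular B" and d: "diag_mat B = es"
    by auto
  from similar_mat_witD2[OF A sim]
  have c: "B \<in> carrier_mat n n" "P \<in> carrier_mat n n" "Q \<in> carrier_mat n n"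
    and QP: "Q * P = 1\<^sub>m n" by auto
  have "set es = {x. eigenvalue A x}"
    unfolding eigenvalue_root_char_poly[OF A] es by (induction es) auto
  moreover have "(\<Sum>i<n. (A ^\<^sub>m m) $$ (i,i)) = (\<Sum>x\<leftarrow>es. x ^ m)" for m
  proof -
    have cm: "B ^\<^sub>m m \<in> carrier_mat n n" using c by auto
    have "A ^\<^sub>m m = P * (B ^\<^sub>m m * Q)"
      using similar_mat_wit_pow_id[OF sim] c cm by (simp add: assoc_mult_mat[of _ n n _ n _ n])
    then have "(\<Sum>i<n. (A ^\<^sub>m m) $$ (i,i)) = (\<Sum>i<n. (B ^\<^sub>m m * Q * P) $$ (i,i))"
      using trace_mult_commute_jnf[OF c(2) mult_carrier_mat[OF cm c(3)]] by (simp only:)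
    also have "B ^\<^sub>m m * Q * P = B ^\<^sub>m m"
      using c cm QP by (simp add: assoc_mult_mat[of _ n n _ n _ n])
    also have "(\<Sum>i<n. (B ^\<^sub>m m) $$ (i,i)) = (\<Sum>i<n. (B $$ (i,i)) ^ m)"
      using upper_triangular_pow[OF c(1) ut] by auto
    also have "\<dots> = (\<Sum>x\<leftarrow>es. x ^ m)"
      using c(1) by (simp add: d[symmetric] diag_mat_def interv_sum_list_conv_sum_set_nat
          lessThan_atLeast0 comp_def)
    finally show ?thesis .
  qed
  ultimately show ?thesis by blast
qed

text \<open>The index set is enumerated to pass to matrices indexed by numbers; eigenvectors and
  powers are transported along the enumeration.\<close>

lemma trace_powers_eigenvalues:
  assumes I: "finite I"
  shows "\<exists>es. set es = {x. mat_eigenvalue I M x} \<and>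
           (\<forall>m. mat_trace I (mat_pow I M m) = (\<Sum>x\<leftarrow>es. x ^ m))"
proof -
  define n where "n = card I"
  from ex_bij_betw_nat_finite[OF I] obtain f where "bij_betw f {0..<card I} I" by blast
  then have f: "bij_betw f {..<n} I" by (simp add: n_def lessThan_atLeast0)
  have fI: "f i \<in> I" if "i < n" for i using f that by (auto simp: bij_betw_def)
  have finj: "f i = f j \<longleftrightarrow> i = j" if "i < n" "j < n" for i j
    using f that by (auto simp: bij_betw_def inj_on_def)
  have sumI: "(\<Sum>a\<in>I. h a) = (\<Sum>i<n. h (f i))" for h :: "_ \<Rightarrow> complex"
    using sum.reindex_bij_betw[OF f, of h] by simp
  define A where "A = Matrix.mat n n (\<lambda>(i,j). M (f i) (f j))"
  have A: "A \<in> carrier_mat n n" by (simp add: A_def)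
  have pow: "\<forall>i<n. \<forall>j<n. (A ^\<^sub>m m) $$ (i,j) = mat_pow I M m (f i) (f j)" for m
  proof (induction m)
    case 0
    show ?case using A fI finj by (auto simp: id_mat_def)
  next
    case (Suc m)
    have "A ^\<^sub>m m \<in> carrier_mat n n" using A by auto
    then show ?case using A Suc fI
      by (auto simp: mat_mult_def sumI scalar_prod_def lessThan_atLeast0 A_def intro!: sum.cong)
  qed
  have ev: "eigenvalue A x \<longleftrightarrow> mat_eigenvalue I M x" for x
  proof
    assume "eigenvalue A x"
    then obtain v where v: "v \<in> carrier_vec n" "v \<noteq> 0\<^sub>v n" "A *\<^sub>v v = x \<cdot>\<^sub>v v"
      using A by (auto simp: eigenvalue_def eigenvector_def)
    define g where "g = inv_into {..<n} f"
    have gf: "g (f i) = i" if "i < n" for i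
      using f that by (auto simp: g_def bij_betw_def inv_into_f_f)
    have "\<exists>i<n. v $ i \<noteq> 0" using v by (metis carrier_vecD eq_vecI index_zero_vec)
    then have "\<exists>a\<in>I. v $ g a \<noteq> 0" using gf fI by force
    moreover have "(\<Sum>b\<in>I. M a b * (v $ g b)) = x * (v $ g a)" if a: "a \<in> I" for a
    proof -
      obtain i where i: "i < n" "a = f i" using f a by (auto simp: bij_betw_def)
      have "(A *\<^sub>v v) $ i = x * v $ i" using v i by simp
      then show ?thesis using i v(1) A
        by (simp add: sumI gf scalar_prod_def lessThan_atLeast0 A_def)
    qed
    ultimately show "mat_eigenvalue I M x"
      unfolding mat_eigenvalue_def by (intro exI[of _ "\<lambda>a. v $ g a"]) auto
  next
    assume "mat_eigenvalue I M x"
    then obtain v where v: "\<exists>a\<in>I. v a \<noteq> 0" "\<And>a. a \<in> I \<Longrightarrow> (\<Sum>b\<in>I. M a b * v b) = x * v a"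
      by (auto simp: mat_eigenvalue_def)
    define w where "w = vec n (\<lambda>i. v (f i))"
    obtain i where i: "i < n" "v (f i) \<noteq> 0" using v(1) f by (auto simp: bij_betw_def)
    then have "w \<noteq> 0\<^sub>v n" by (metis index_vec index_zero_vec(1) w_def)
    moreover have "A *\<^sub>v w = x \<cdot>\<^sub>v w"
    proof (rule eq_vecI)
      fix j assume "j < dim_vec (x \<cdot>\<^sub>v w)"
      then have j: "j < n" by (simp add: w_def)
      show "(A *\<^sub>v w) $ j = (x \<cdot>\<^sub>v w) $ j"
        using v(2)[OF fI[OF j]] j by (simp add: sumI scalar_prod_def lessThan_atLeast0 A_def w_def)
    qed (simp add: A_def w_def)
    ultimately show "eigenvalue A x" using A
      by (auto simp: eigenvalue_def eigenvector_def w_def intro!: exI[of _ w])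
  qed
  from trace_powers_jnf[OF A] obtain es where "set es = {x. eigenvalue A x}"
    "\<forall>m. (\<Sum>i<n. (A ^\<^sub>m m) $$ (i,i)) = (\<Sum>x\<leftarrow>es. x ^ m)" by blast
  then show ?thesis using pow ev
    by (intro exI[of _ es]) (auto simp: mat_trace_def sumI)
qed


section \<open>Algebra of matrices supported on the index set\<close>

definition mat_on :: "'a set \<Rightarrow> ('a \<Rightarrow> 'a \<Rightarrow> complex) \<Rightarrow> bool" where
  "mat_on I M \<longleftrightarrow> (\<forall>a b. a \<notin> I \<or> b \<notin> I \<longrightarrow> M a b = 0)"

lemma mat_on_mult [simp]: "mat_on I (mat_mult I M N)"
  by (simp add: mat_on_def mat_mult_def)

lemma mat_on_id [simp]: "mat_on I (id_mat I)"
  by (simp add: mat_on_def id_mat_def)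

lemma mat_on_pow [simp]: "mat_on I (mat_pow I M m)"
  by (cases m) simp_all

lemma mat_mult_assoc:
  "mat_mult I (mat_mult I A B) C = mat_mult I A (mat_mult I B C)"
proof (intro ext)
  fix a b
  have "(\<Sum>c\<in>I. (\<Sum>d\<in>I. A a d * B d c) * C c b) = (\<Sum>c\<in>I. \<Sum>d\<in>I. A a d * (B d c * C c b))"
    by (simp add: sum_distrib_right mult.assoc)
  also have "\<dots> = (\<Sum>d\<in>I. \<Sum>c\<in>I. A a d * (B d c * C c b))"
    by (rule sum.swap)
  also have "\<dots> = (\<Sum>d\<in>I. A a d * (\<Sum>c\<in>I. B d c * C c b))"
    by (simp add: sum_distrib_left)
  finally show "mat_mult I (mat_mult I A B) C a b = mat_mult I A (mat_mult I B C) a b"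
    by (simp add: mat_mult_def)
qed

text \<open>Multiplication sets all entries outside \<open>I\<close> to 0, so
  \<open>id_mat I\<close> can only be neutral for matrices that vanish there already.\<close>

lemma mat_mult_id_left [simp]:
  assumes "finite I" "mat_on I M"
  shows "mat_mult I (id_mat I) M = M"
proof (intro ext)
  fix a b
  show "mat_mult I (id_mat I) M a b = M a b"
  proof (cases "a \<in> I \<and> b \<in> I")
    case True
    have "mat_mult I (id_mat I) M a b = (\<Sum>c\<in>I. if a = c then M c b else 0)"
      using True unfolding mat_mult_def id_mat_def by (auto intro!: sum.cong)
    then show ?thesis using True assms by simp
  qed (use assms in \<open>auto simp: mat_on_def mat_mult_def\<close>)
qed

lemma mat_mult_id_right [simp]:
  assumes "finite I" "mat_on I M"
  shows "mat_mult I M (id_mat I) = M"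
proof (intro ext)
  fix a b
  show "mat_mult I M (id_mat I) a b = M a b"
  proof (cases "a \<in> I \<and> b \<in> I")
    case True
    have "mat_mult I M (id_mat I) a b = (\<Sum>c\<in>I. if c = b then M a c else 0)"
      using True unfolding mat_mult_def id_mat_def by (auto intro!: sum.cong)
    then show ?thesis using True assms by simp
  qed (use assms in \<open>auto simp: mat_on_def mat_mult_def\<close>)
qed

lemma mat_mult_sum_right:
  "mat_mult I M (\<lambda>a b. \<Sum>j\<in>J. c j * N j a b) = (\<lambda>a b. \<Sum>j\<in>J. c j * mat_mult I M (N j) a b)"
proof (intro ext)
  fix a b
  have "(\<Sum>d\<in>I. M a d * (\<Sum>j\<in>J. c j * N j d b)) = (\<Sum>d\<in>I. \<Sum>j\<in>J. c j * (M a d * N j d b))"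
    by (simp add: sum_distrib_left mult_ac)
  also have "\<dots> = (\<Sum>j\<in>J. \<Sum>d\<in>I. c j * (M a d * N j d b))"
    by (rule sum.swap)
  finally show "mat_mult I M (\<lambda>a b. \<Sum>j\<in>J. c j * N j a b) a b
      = (\<Sum>j\<in>J. c j * mat_mult I M (N j) a b)"
    by (auto simp: mat_mult_def sum_distrib_left)
qed

lemma mat_mult_sum_left:
  "mat_mult I (\<lambda>a b. \<Sum>j\<in>J. c j * N j a b) M = (\<lambda>a b. \<Sum>j\<in>J. c j * mat_mult I (N j) M a b)"
proof (intro ext)
  fix a b
  have "(\<Sum>d\<in>I. (\<Sum>j\<in>J. c j * N j a d) * M d b) = (\<Sum>d\<in>I. \<Sum>j\<in>J. c j * (N j a d * M d b))"
    by (simp add: sum_distrib_left sum_distrib_right mult_ac)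
  also have "\<dots> = (\<Sum>j\<in>J. \<Sum>d\<in>I. c j * (N j a d * M d b))"
    by (rule sum.swap)
  finally show "mat_mult I (\<lambda>a b. \<Sum>j\<in>J. c j * N j a b) M a b
      = (\<Sum>j\<in>J. c j * mat_mult I (N j) M a b)"
    by (auto simp: mat_mult_def sum_distrib_left)
qed

lemma mat_mult_scale_right:
  "mat_mult I M (\<lambda>a b. c * N a b) = (\<lambda>a b. c * mat_mult I M N a b)"
  by (intro ext) (simp add: mat_mult_def sum_distrib_left mult_ac)

lemma mat_trace_sum: "mat_trace I (\<lambda>a b. \<Sum>j\<in>J. c j * N j a b) = (\<Sum>j\<in>J. c j * mat_trace I (N j))"
  unfolding mat_trace_def by (subst sum.swap) (simp add: sum_distrib_left)

lemma mat_pow_commute: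
  assumes "finite I" "mat_on I A" "mat_mult I M A = mat_mult I A M"
  shows "mat_mult I (mat_pow I M m) A = mat_mult I A (mat_pow I M m)"
proof (induction m)
  case 0
  show ?case using assms by simp
next
  case (Suc m)
  have "mat_mult I (mat_pow I M (Suc m)) A = mat_mult I (mat_pow I M m) (mat_mult I A M)"
    by (simp add: mat_mult_assoc assms)
  also have "\<dots> = mat_mult I A (mat_pow I M (Suc m))"
    using Suc by (simp add: mat_mult_assoc[symmetric])
  finally show ?case .
qed

lemma mat_pow_Suc_left:
  assumes "finite I" "mat_on I M"
  shows "mat_pow I M (Suc m) = mat_mult I M (mat_pow I M m)"
  using mat_pow_commute[OF assms refl] by simp

text \<open>The matrix \<open>P j\<close> projects onto the eigenspace of \<open>A\<close> for \<open>\<zeta> ^ j\<close>; since it commutes with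
  \<open>M\<close>, the traces of \<open>M ^ m * P j\<close> are power sums of eigenvalues of \<open>M\<close>.\<close>

lemma trace_mult_finite_order:
  assumes I: "finite I" and n: "n > 0"
    and A: "mat_on I A" "mat_pow I A n = id_mat I"
    and M: "mat_on I M" "mat_mult I M A = mat_mult I A M"
  shows "\<exists>es. (\<forall>j<n. \<forall>x\<in>set (es j). x = 0 \<or> mat_eigenvalue I M x) \<and>
          (\<forall>m k. mat_trace I (mat_mult I (mat_pow I M (Suc m)) (mat_pow I A k))
             = (\<Sum>j<n. zeta n ^ (j * k) * (\<Sum>x\<leftarrow>es j. x ^ Suc m)))"
proof -
  define w u where "w = zeta n" and "u = inverse w"
  have w: "w \<noteq> 0" "w ^ n = 1" "u * w = 1" "u ^ n = 1"
    using zeta_power_order[OF n] by (simp_all add: w_def u_def power_inverse)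
  \<comment> \<open>The discrete Fourier transform of the powers of \<open>A\<close>: the average of
    \<open>A ^ i\<close> weighted with \<open>\<zeta> ^ (- i j)\<close>.\<close>
  define P where "P = (\<lambda>j a b. \<Sum>i<n. (u ^ (i * j) / of_nat n) * mat_pow I A i a b)"
  have P_on: "mat_on I (P j)" for j
    using mat_on_pow[of I A] by (simp add: P_def mat_on_def)
  have AP: "mat_mult I A (P j) = (\<lambda>a b. w ^ j * P j a b)" for j
  proof (intro ext)
    fix a b
    let ?f = "\<lambda>i. u ^ (i * j) / of_nat n * mat_pow I A i a b"
    have shift: "u ^ (i * j) = w ^ j * u ^ (Suc i * j)" for i
    proof -
      have "w ^ j * u ^ j = 1" using w(3) by (metis mult.commute power_mult_distrib power_one)
      then show ?thesis by (simp add: power_add)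
    qed
    have "mat_mult I A (P j) a b
        = (\<Sum>i<n. u ^ (i * j) / of_nat n * mat_pow I A (Suc i) a b)"
      using I A(1) by (simp only: P_def mat_mult_sum_right mat_pow_Suc_left)
    also have "\<dots> = (\<Sum>i<n. w ^ j * ?f (Suc i))"
      by (intro sum.cong refl, subst shift) (simp only: times_divide_eq_right times_divide_eq_left mult.assoc)
    also have "\<dots> = w ^ j * (\<Sum>i<n. ?f (Suc i))"
      by (simp only: sum_distrib_left)
    \<comment> \<open>The shift by one is cyclic: both \<open>u ^ n = 1\<close> and
      \<open>A ^ n = id\<close>, so the new last term equals the lost first one.\<close>
    also have "(\<Sum>i<n. ?f (Suc i)) = (\<Sum>i<Suc n. ?f i) - ?f 0"
      by (simp only: sum.lessThan_Suc_shift add_diff_cancel_left')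
    also have "\<dots> = (\<Sum>i<n. ?f i) + (?f n - ?f 0)"
      by (simp only: sum.lessThan_Suc add_diff_eq)
    also have "?f n = ?f 0"
      using w(4) A(2) by (simp add: power_mult)
    finally show "mat_mult I A (P j) a b = w ^ j * P j a b"
      by (simp add: P_def)
  qed
  have AkP: "mat_mult I (mat_pow I A k) (P j) = (\<lambda>a b. w ^ (j * k) * P j a b)" for j k
  proof (induction k)
    case 0
    show ?case using I P_on by simp
  next
    case (Suc k)
    have "mat_mult I (mat_pow I A (Suc k)) (P j) = mat_mult I (mat_pow I A k) (mat_mult I A (P j))"
      by (simp add: mat_mult_assoc)
    also have "\<dots> = (\<lambda>a b. w ^ j * (w ^ (j * k) * P j a b))"
      by (simp only: AP mat_mult_scale_right Suc)
    finally show ?case by (simp add: power_add mult_ac)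
  qed
  have PP: "mat_mult I (P j) (P j) = P j" for j
  proof (intro ext)
    fix a b
    have *: "u ^ (i * j) * w ^ (j * i) = 1" for i
      using w(3) by (metis mult.commute power_mult_distrib power_one)
    have "mat_mult I (P j) (P j) a b
        = (\<Sum>i<n. (u ^ (i * j) / of_nat n) * (w ^ (j * i) * P j a b))"
      by (subst (1) P_def) (simp only: mat_mult_sum_left AkP)
    also have "\<dots> = (\<Sum>i<n. (u ^ (i * j) * w ^ (j * i)) * P j a b / of_nat n)"
      by (simp add: mult_ac)
    also have "\<dots> = P j a b" using n by (simp only: *) simp
    finally show "mat_mult I (P j) (P j) a b = P j a b" .
  qed
  have sumP: "(\<Sum>j<n. P j a b) = id_mat I a b" for a b
  proof -
    have "(\<Sum>j<n. P j a b) = (\<Sum>i<n. \<Sum>j<n. (u ^ (i * j) / of_nat n) * mat_pow I A i a b)"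
      unfolding P_def by (rule sum.swap)
    also have "\<dots> = (\<Sum>i<n. (\<Sum>j<n. u ^ (i * j)) / of_nat n * mat_pow I A i a b)"
      by (simp add: sum_distrib_right sum_divide_distrib)
    also have "\<dots> = (\<Sum>i<n. if i = 0 then id_mat I a b else 0)"
      using n by (intro sum.cong refl) (auto simp: u_def w_def sum_zeta_powers)
    also have "\<dots> = id_mat I a b" using n by simp
    finally show ?thesis .
  qed
  have Ak: "mat_pow I A k = (\<lambda>a b. \<Sum>j<n. w ^ (j * k) * P j a b)" for k
  proof -
    have "id_mat I = (\<lambda>a b. \<Sum>j<n. 1 * P j a b)" by (intro ext) (simp add: sumP)
    then have "mat_pow I A k = mat_mult I (mat_pow I A k) (\<lambda>a b. \<Sum>j<n. 1 * P j a b)"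
      using I by (metis mat_mult_id_right mat_on_pow)
    also have "\<dots> = (\<lambda>a b. \<Sum>j<n. w ^ (j * k) * P j a b)"
      by (simp only: mat_mult_sum_right AkP) simp
    finally show ?thesis .
  qed
  have MP: "mat_mult I M (P j) = mat_mult I (P j) M" for j
  proof -
    have "mat_mult I M (mat_pow I A i) = mat_mult I (mat_pow I A i) M" for i
      using mat_pow_commute[OF I M(1), of A i] M(2) by simp
    then show ?thesis by (simp only: P_def mat_mult_sum_left mat_mult_sum_right)
  qed
  \<comment> \<open>\<open>M\<close> on the \<open>j\<close>-th eigenspace of \<open>A\<close>,
    extended by 0 to the other eigenspaces. Its powers are \<open>M ^ m * P j\<close> only for
    positive exponents, since the zeroth power is the full identity; hence \<open>Suc m\<close> from
    here on.\<close>
  define N where "N = (\<lambda>j. mat_mult I M (P j))"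
  have PN: "mat_mult I (P j) (N j) = N j" for j
    by (simp add: N_def MP PP flip: mat_mult_assoc)
  have Npow: "mat_pow I (N j) (Suc m) = mat_mult I (mat_pow I M (Suc m)) (P j)" for j m
  proof (induction m)
    case 0
    show ?case using I M by (simp add: N_def)
  next
    case (Suc m)
    have "mat_pow I (N j) (Suc (Suc m)) = mat_mult I (mat_mult I (mat_pow I M (Suc m)) (P j)) (N j)"
      using Suc by simp
    also have "\<dots> = mat_mult I (mat_pow I M (Suc m)) (mat_mult I M (P j))"
      by (simp only: mat_mult_assoc PN) (simp only: N_def)
    finally show ?case by (simp add: mat_mult_assoc)
  qed
  have "\<exists>es. set es = {x. mat_eigenvalue I (N j) x} \<and>
           (\<forall>m. mat_trace I (mat_pow I (N j) m) = (\<Sum>x\<leftarrow>es. x ^ m))" for j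
    by (rule trace_powers_eigenvalues[OF I])
  then obtain es where es: "\<And>j. set (es j) = {x. mat_eigenvalue I (N j) x}"
    "\<And>j m. mat_trace I (mat_pow I (N j) m) = (\<Sum>x\<leftarrow>es j. x ^ m)" by metis
  have "x = 0 \<or> mat_eigenvalue I M x" if x: "x \<in> set (es j)" for x j
  proof (cases "x = 0")
    case False
    obtain v where v: "\<exists>a\<in>I. v a \<noteq> 0" "\<And>a. a \<in> I \<Longrightarrow> (\<Sum>b\<in>I. N j a b * v b) = x * v a"
      using x unfolding es(1) mat_eigenvalue_def by blast
    have act: "(\<Sum>b\<in>I. mat_mult I X Y a b * v b) = (\<Sum>c\<in>I. X a c * (\<Sum>b\<in>I. Y c b * v b))"
      if "a \<in> I" for X Y a
    proof -
      have "(\<Sum>b\<in>I. mat_mult I X Y a b * v b) = (\<Sum>b\<in>I. \<Sum>c\<in>I. X a c * (Y c b * v b))"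
        using that by (simp add: mat_mult_def sum_distrib_right mult.assoc)
      also have "\<dots> = (\<Sum>c\<in>I. \<Sum>b\<in>I. X a c * (Y c b * v b))" by (rule sum.swap)
      finally show ?thesis by (simp add: sum_distrib_left)
    qed
    \<comment> \<open>For a nonzero eigenvalue, \<open>x v = N v = P N v = x P v\<close> forces
      \<open>v\<close> into the eigenspace of \<open>A\<close>, where \<open>N\<close> and
      \<open>M\<close> agree. Eigenvalue 0 may stem from the complement and is therefore left as an
      exception.\<close>
    have Pv: "(\<Sum>b\<in>I. P j a b * v b) = v a" if a: "a \<in> I" for a
    proof -
      have "x * v a = (\<Sum>c\<in>I. P j a c * (x * v c))"
        using act[OF a, of "P j" "N j"] v(2) a by (simp add: PN)
      also have "\<dots> = x * (\<Sum>c\<in>I. P j a c * v c)"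
        by (simp add: sum_distrib_left mult_ac)
      finally show ?thesis using False by simp
    qed
    have "(\<Sum>b\<in>I. M a b * v b) = x * v a" if a: "a \<in> I" for a
      using act[OF a, of M "P j"] v(2)[OF a] Pv by (simp add: N_def)
    then show ?thesis using v(1) by (auto simp: mat_eigenvalue_def)
  qed simp
  moreover have "mat_trace I (mat_mult I (mat_pow I M (Suc m)) (mat_pow I A k))
      = (\<Sum>j<n. zeta n ^ (j * k) * (\<Sum>x\<leftarrow>es j. x ^ Suc m))" for m k
  proof -
    have "mat_mult I (mat_pow I M (Suc m)) (mat_pow I A k)
        = (\<lambda>a b. \<Sum>j<n. w ^ (j * k) * mat_pow I (N j) (Suc m) a b)"
      by (subst Ak) (simp only: mat_mult_sum_right Npow)
    then show ?thesis by (simp only: mat_trace_sum es(2) w_def)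
  qed
  ultimately show ?thesis by blast
qed

section \<open>Matrices of group algebra elements\<close>

locale finite_group = group G for G (structure) +
  assumes finite_carrier [simp]: "finite (carrier G)"
begin

lemma inv_cancel [simp]:
  "x \<in> carrier G \<Longrightarrow> y \<in> carrier G \<Longrightarrow> inv x \<otimes> (x \<otimes> y) = y"
  "x \<in> carrier G \<Longrightarrow> y \<in> carrier G \<Longrightarrow> x \<otimes> (inv x \<otimes> y) = y"
  by (simp_all add: m_assoc[symmetric])

lemma group_exponent_pos: "group_exponent G > 0"
  and pow_group_exponent: "g \<in> carrier G \<Longrightarrow> g [^] group_exponent G = \<one>"
proof -
  have "card (carrier G) > 0 \<and> (\<forall>g\<in>carrier G. g [^] card (carrier G) = \<one>)"
    using pow_order_eq_1 card_gt_0_iff[of "carrier G"] finite_carrier one_closed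
    unfolding Coset.order_def by blast
  then have "group_exponent G > 0 \<and> (\<forall>g\<in>carrier G. g [^] group_exponent G = \<one>)"
    unfolding group_exponent_def by (rule LeastI)
  then show "group_exponent G > 0" "g \<in> carrier G \<Longrightarrow> g [^] group_exponent G = \<one>" by auto
qed

lemma pow_mod_exponent:
  assumes "g \<in> carrier G"
  shows "g [^] (m mod group_exponent G) = g [^] m"
proof -
  have "g [^] m = g [^] (group_exponent G * (m div group_exponent G) + m mod group_exponent G)"
    by simp
  also have "\<dots> = (g [^] group_exponent G) [^] (m div group_exponent G) \<otimes> g [^] (m mod group_exponent G)"
    using assms by (simp only: nat_pow_mult nat_pow_pow nat_pow_closed)
  also have "\<dots> = g [^] (m mod group_exponent G)"
    using assms by (simp add: pow_group_exponent)
  finally show ?thesis ..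
qed

lemma pow_cong_exponent:
  assumes "g \<in> carrier G" "[m = l] (mod group_exponent G)"
  shows "g [^] m = g [^] l"
  using pow_mod_exponent[OF assms(1), of m] pow_mod_exponent[OF assms(1), of l] assms(2)
  by (simp add: cong_def)

lemma conjugate_pow:
  assumes "x \<in> carrier G" "g \<in> carrier G"
  shows "(x \<otimes> g \<otimes> inv x) [^] (m::nat) = x \<otimes> g [^] m \<otimes> inv x"
proof (induction m)
  case 0
  show ?case using assms by simp
next
  case (Suc m)
  then show ?case using assms by (simp add: m_assoc)
qed

end

section \<open>The group algebra as matrices: convolution and class functions\<close>

definition cayley_mat :: "('a, 'b) monoid_scheme \<Rightarrow> ('a \<Rightarrow> complex) \<Rightarrow> 'a \<Rightarrow> 'a \<Rightarrow> complex" where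
  "cayley_mat G c = (\<lambda>a b. if a \<in> carrier G \<and> b \<in> carrier G then c (b \<otimes>\<^bsub>G\<^esub> inv\<^bsub>G\<^esub> a) else 0)"

text \<open>The order of the factors follows matrix multiplication: in \<open>z = (z y^-1) y\<close>
  the function \<open>c\<close> takes the right-hand factor. Compared with the group algebra,
  products are reversed.\<close>

definition conv :: "('a, 'b) monoid_scheme \<Rightarrow> ('a \<Rightarrow> complex) \<Rightarrow> ('a \<Rightarrow> complex) \<Rightarrow> 'a \<Rightarrow> complex" where
  "conv G c d = (\<lambda>z. \<Sum>y\<in>carrier G. c y * d (z \<otimes>\<^bsub>G\<^esub> inv\<^bsub>G\<^esub> y))"

definition class_fun :: "('a, 'b) monoid_scheme \<Rightarrow> ('a \<Rightarrow> complex) \<Rightarrow> bool" where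
  "class_fun G c \<longleftrightarrow> (\<forall>g\<in>carrier G. \<forall>x\<in>carrier G. c (x \<otimes>\<^bsub>G\<^esub> g \<otimes>\<^bsub>G\<^esub> inv\<^bsub>G\<^esub> x) = c g)"

context finite_group
begin

lemma mat_on_cayley [simp]: "mat_on (carrier G) (cayley_mat G c)"
  by (simp add: mat_on_def cayley_mat_def)

lemma cayley_mat_eq_iff: "cayley_mat G c = cayley_mat G d \<longleftrightarrow> (\<forall>g\<in>carrier G. c g = d g)"
proof
  assume eq: "cayley_mat G c = cayley_mat G d"
  show "\<forall>g\<in>carrier G. c g = d g"
  proof
    fix g assume g: "g \<in> carrier G"
    from eq have "cayley_mat G c \<one> g = cayley_mat G d \<one> g" by simp
    then show "c g = d g" using g by (simp add: cayley_mat_def)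
  qed
qed (auto simp: cayley_mat_def fun_eq_iff)

lemma set_mat_eq_cayley:
  assumes "C \<subseteq> carrier G"
  shows "set_mat G C = cayley_mat G (\<lambda>g. if g \<in> C then 1 else 0)"
  using finite_subset[OF assms] unfolding set_mat_def perm_mat_def cayley_mat_def
  by (auto simp: fun_eq_iff)

lemma perm_mat_eq_cayley:
  "perm_mat G g = cayley_mat G (\<lambda>h. if h = g then 1 else 0)"
  unfolding perm_mat_def cayley_mat_def by (auto simp: fun_eq_iff)

lemma cayley_mat_eq_sum:
  "cayley_mat G c = (\<lambda>a b. \<Sum>g\<in>carrier G. c g * perm_mat G g a b)"
proof (intro ext)
  fix a b
  have "(\<Sum>g\<in>carrier G. c g * perm_mat G g a b)
      = (\<Sum>g\<in>carrier G. if b \<otimes> inv a = g then (if a \<in> carrier G \<and> b \<in> carrier G then c g else 0) else 0)"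
    by (intro sum.cong) (auto simp: perm_mat_def)
  then show "cayley_mat G c a b = (\<Sum>g\<in>carrier G. c g * perm_mat G g a b)"
    by (auto simp: cayley_mat_def)
qed

lemma sum_carrier_shift:
  assumes "a \<in> carrier G"
  shows "(\<Sum>y\<in>carrier G. f (y \<otimes> a)) = (\<Sum>y\<in>carrier G. f y)"
  using assms
  by (intro sum.reindex_bij_witness[of _ "\<lambda>y. y \<otimes> inv a" "\<lambda>y. y \<otimes> a"]) (auto simp: m_assoc)

lemma mat_mult_cayley:
  "mat_mult (carrier G) (cayley_mat G c) (cayley_mat G d) = cayley_mat G (conv G c d)"
proof (intro ext)
  fix a b
  show "mat_mult (carrier G) (cayley_mat G c) (cayley_mat G d) a b = cayley_mat G (conv G c d) a b"
  proof (cases "a \<in> carrier G \<and> b \<in> carrier G")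
    case True
    have "mat_mult (carrier G) (cayley_mat G c) (cayley_mat G d) a b
        = (\<Sum>x\<in>carrier G. c (x \<otimes> inv a) * d (b \<otimes> inv x))"
      using True by (simp add: mat_mult_def cayley_mat_def)
    also have "\<dots> = (\<Sum>y\<in>carrier G. c (y \<otimes> a \<otimes> inv a) * d (b \<otimes> inv (y \<otimes> a)))"
      using True by (intro sum_carrier_shift[symmetric]) simp
    also have "\<dots> = conv G c d (b \<otimes> inv a)"
      unfolding conv_def using True by (intro sum.cong) (auto simp: inv_mult_group m_assoc)
    finally show ?thesis using True by (simp add: cayley_mat_def)
  qed (auto simp: mat_mult_def cayley_mat_def)
qed

lemma class_fun_swap:
  assumes "class_fun G c" "x \<in> carrier G" "y \<in> carrier G"
  shows "c (x \<otimes> y) = c (y \<otimes> x)"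
proof -
  have "c (x \<otimes> (y \<otimes> x) \<otimes> inv x) = c (y \<otimes> x)"
    using assms by (simp add: class_fun_def del: m_assoc)
  then show ?thesis using assms by (simp add: m_assoc)
qed

text \<open>Class functions are central. The substitution of \<open>z y^-1\<close> for
  \<open>y\<close> exchanges the factors and turns the argument of \<open>c\<close> into
  \<open>z y z^-1\<close>, a conjugate of \<open>y\<close>.\<close>

lemma conv_commute:
  assumes c: "class_fun G c" and z: "z \<in> carrier G"
  shows "conv G c d z = conv G d c z"
  unfolding conv_def
proof (rule sum.reindex_bij_witness[of _ "\<lambda>y. inv y \<otimes> z" "\<lambda>y. z \<otimes> inv y"])
  fix y assume y: "y \<in> carrier G"
  show "inv (z \<otimes> inv y) \<otimes> z = y" "z \<otimes> inv (inv y \<otimes> z) = y"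
    using y z by (simp_all add: inv_mult_group m_assoc)
  show "z \<otimes> inv y \<in> carrier G" "inv y \<otimes> z \<in> carrier G" using y z by auto
  have "c (z \<otimes> inv (z \<otimes> inv y)) = c (inv (z \<otimes> inv y) \<otimes> z)"
    using y z c by (intro class_fun_swap) auto
  also have "inv (z \<otimes> inv y) \<otimes> z = y" using y z by (simp add: inv_mult_group m_assoc)
  finally show "d (z \<otimes> inv y) * c (z \<otimes> inv (z \<otimes> inv y)) = c y * d (z \<otimes> inv y)" by simp
qed

lemma cayley_mat_commute:
  assumes "class_fun G c"
  shows "mat_mult (carrier G) (cayley_mat G c) (cayley_mat G d)
       = mat_mult (carrier G) (cayley_mat G d) (cayley_mat G c)"
  using conv_commute[OF assms] by (simp add: mat_mult_cayley cayley_mat_eq_iff)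

lemma class_fun_conv:
  assumes c: "class_fun G c" and d: "class_fun G d"
  shows "class_fun G (conv G c d)"
  unfolding class_fun_def
proof (intro ballI)
  fix z x assume z: "z \<in> carrier G" and x: "x \<in> carrier G"
  show "conv G c d (x \<otimes> z \<otimes> inv x) = conv G c d z"
    unfolding conv_def
  proof (rule sum.reindex_bij_witness[of _ "\<lambda>y. x \<otimes> y \<otimes> inv x" "\<lambda>y. inv x \<otimes> y \<otimes> x"])
    fix y assume y: "y \<in> carrier G"
    show "x \<otimes> (inv x \<otimes> y \<otimes> x) \<otimes> inv x = y"
      using x y by (simp add: m_assoc)
    show "inv x \<otimes> (x \<otimes> y \<otimes> inv x) \<otimes> x = y"
      using x y by (simp add: m_assoc)
    have "c (inv x \<otimes> y \<otimes> x) = c y"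
      using c x y unfolding class_fun_def by (metis inv_closed inv_inv)
    moreover have "d (x \<otimes> z \<otimes> inv x \<otimes> inv y) = d (z \<otimes> inv (inv x \<otimes> y \<otimes> x))"
    proof -
      have "d (x \<otimes> (z \<otimes> inv (inv x \<otimes> y \<otimes> x)) \<otimes> inv x) = d (z \<otimes> inv (inv x \<otimes> y \<otimes> x))"
        using d x y z unfolding class_fun_def by blast
      moreover have "x \<otimes> (z \<otimes> inv (inv x \<otimes> y \<otimes> x)) \<otimes> inv x = x \<otimes> z \<otimes> inv x \<otimes> inv y"
        using x y z by (simp add: inv_mult_group m_assoc)
      ultimately show ?thesis by simp
    qed
    ultimately show "c (inv x \<otimes> y \<otimes> x) * d (z \<otimes> inv (inv x \<otimes> y \<otimes> x))
        = c y * d (x \<otimes> z \<otimes> inv x \<otimes> inv y)" by simp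
  qed (use x in auto)
qed

lemma id_mat_eq_perm: "id_mat (carrier G) = perm_mat G \<one>"
proof (intro ext)
  fix a b
  have "b \<otimes> inv a = \<one> \<longleftrightarrow> a = b" if "a \<in> carrier G" "b \<in> carrier G"
    using that by (metis inv_closed inv_equality inv_inv r_inv)
  then show "id_mat (carrier G) a b = perm_mat G \<one> a b"
    by (auto simp: id_mat_def perm_mat_def)
qed

text \<open>An arc from \<open>a\<close> to \<open>b\<close> means \<open>b = g a\<close>; following
  it by an arc for \<open>h\<close> multiplies by \<open>h\<close> on the left, hence the reversed
  product.\<close>

lemma perm_mat_mult:
  assumes "g \<in> carrier G" "h \<in> carrier G"
  shows "mat_mult (carrier G) (perm_mat G g) (perm_mat G h) = perm_mat G (h \<otimes> g)"
proof -
  have "conv G (\<lambda>x. if x = g then 1 else 0) (\<lambda>x. if x = h then 1 else 0) z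
      = (if z = h \<otimes> g then 1 else 0)" if z: "z \<in> carrier G" for z
  proof -
    have "conv G (\<lambda>x. if x = g then 1 else 0) (\<lambda>x. if x = h then 1 else 0) z
       = (\<Sum>y\<in>carrier G. if y = g then (if z \<otimes> inv g = h then 1 else 0) else 0)"
      unfolding conv_def by (intro sum.cong) auto
    moreover have "z \<otimes> inv g = h \<longleftrightarrow> z = h \<otimes> g"
      using assms z by (metis inv_solve_right')
    ultimately show ?thesis using assms by simp
  qed
  then show ?thesis by (simp add: perm_mat_eq_cayley mat_mult_cayley cayley_mat_eq_iff)
qed

lemma mat_pow_perm:
  assumes "g \<in> carrier G"
  shows "mat_pow (carrier G) (perm_mat G g) m = perm_mat G (g [^] m)"
proof (induction m)
  case (Suc m)
  then show ?case using assms by (simp add: perm_mat_mult flip: nat_pow_Suc2)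
qed (simp add: id_mat_eq_perm)

lemma mat_trace_cayley: "mat_trace (carrier G) (cayley_mat G c) = of_nat (card (carrier G)) * c \<one>"
  by (simp add: mat_trace_def cayley_mat_def)

lemma mat_trace_cayley_perm:
  assumes g: "g \<in> carrier G"
  shows "mat_trace (carrier G) (mat_mult (carrier G) (cayley_mat G c) (perm_mat G g))
       = of_nat (card (carrier G)) * c (inv g)"
proof -
  have "conv G c (\<lambda>x. if x = g then 1 else 0) \<one> = (\<Sum>y\<in>carrier G. if y = inv g then c y else 0)"
    unfolding conv_def using g by (intro sum.cong) auto
  then show ?thesis using g by (simp add: perm_mat_eq_cayley mat_mult_cayley mat_trace_cayley)
qed

lemma card_carrier_pos: "card (carrier G) > 0"
  using card_gt_0_iff[of "carrier G"] finite_carrier one_closed by blast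

lemma inj_on_set_mat: "inj_on (set_mat G) (Pow (carrier G))"
proof (rule inj_onI)
  fix C D assume CD: "C \<in> Pow (carrier G)" "D \<in> Pow (carrier G)" "set_mat G C = set_mat G D"
  then have "\<forall>g\<in>carrier G. (if g \<in> C then 1 else 0 :: complex) = (if g \<in> D then 1 else 0)"
    by (simp add: set_mat_eq_cayley cayley_mat_eq_iff)
  then show "C = D" using CD(1,2) by (auto split: if_splits)
qed

lemma partition_on_carrier:
  assumes P: "partition_on (carrier G) P"
  shows "finite P" "D \<in> P \<Longrightarrow> D \<subseteq> carrier G" "g \<in> carrier G \<Longrightarrow> \<exists>D\<in>P. g \<in> D"
    "D \<in> P \<Longrightarrow> E \<in> P \<Longrightarrow> g \<in> D \<Longrightarrow> g \<in> E \<Longrightarrow> D = E" "inj_on (set_mat G) P"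
proof -
  show "finite P" using P by (rule finite_elements[OF finite_carrier])
  show sub: "D \<subseteq> carrier G" if "D \<in> P" for D using P that by (auto simp: partition_on_def)
  show "g \<in> carrier G \<Longrightarrow> \<exists>D\<in>P. g \<in> D" using P by (auto simp: partition_on_def)
  show "D \<in> P \<Longrightarrow> E \<in> P \<Longrightarrow> g \<in> D \<Longrightarrow> g \<in> E \<Longrightarrow> D = E"
    using P by (auto simp: partition_on_def disjoint_def)
  show "inj_on (set_mat G) P" using sub by (intro inj_on_subset[OF inj_on_set_mat]) auto
qed

lemma sum_set_mats:
  assumes P: "partition_on (carrier G) P"
    and c: "\<And>D g. D \<in> P \<Longrightarrow> g \<in> D \<Longrightarrow> c g = k (set_mat G D)"
  shows "(\<lambda>a b. \<Sum>X\<in>set_mat G ` P. k X * X a b) = cayley_mat G c"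
proof (intro ext)
  note P' = partition_on_carrier[OF P]
  fix a b
  have "(\<Sum>X\<in>set_mat G ` P. k X * X a b) = (\<Sum>D\<in>P. k (set_mat G D) * set_mat G D a b)"
    by (simp add: sum.reindex[OF P'(5)])
  also have "\<dots> = cayley_mat G c a b"
  proof (cases "a \<in> carrier G \<and> b \<in> carrier G")
    case True
    then obtain E where E: "E \<in> P" "b \<otimes> inv a \<in> E" using P'(3)[of "b \<otimes> inv a"] by auto
    have "(\<Sum>D\<in>P. k (set_mat G D) * set_mat G D a b) = (\<Sum>D\<in>P. if D = E then k (set_mat G E) else 0)"
    proof (rule sum.cong)
      fix D assume D: "D \<in> P"
      have "b \<otimes> inv a \<in> D \<longleftrightarrow> D = E" using P'(4) D E by blast
      then have "set_mat G D a b = (if D = E then 1 else 0)"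
        using True P'(2)[OF D] by (simp add: set_mat_eq_cayley cayley_mat_def)
      then show "k (set_mat G D) * set_mat G D a b = (if D = E then k (set_mat G E) else 0)"
        by simp
    qed simp
    also have "\<dots> = k (set_mat G E)" using E P'(1) by simp
    finally show ?thesis using True c E by (simp add: cayley_mat_def)
  next
    case False
    then show ?thesis using P'(2) by (auto simp: set_mat_eq_cayley cayley_mat_def)
  qed
  finally show "(\<Sum>X\<in>set_mat G ` P. k X * X a b) = cayley_mat G c a b" .
qed

text \<open>Coefficients in \<open>span_over\<close> are attached to matrices. Distinct blocks give
  distinct matrices, so they can be moved to blocks and then to the elements of the blocks. Stated
  for any partition, this serves conjugacy classes and \<open>simF\<close> classes alike.\<close>

lemma span_over_set_mats:
  assumes P: "partition_on (carrier G) P"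
  shows "span_over K (set_mat G ` P) = {cayley_mat G c | c.
           (\<forall>g\<in>carrier G. c g \<in> K) \<and> (\<forall>D\<in>P. \<forall>g\<in>D. \<forall>h\<in>D. c g = c h)}"
proof -
  note sub = partition_on_carrier(2)[OF P] and ex1 = partition_on_carrier(3)[OF P]
    and uniq = partition_on_carrier(4)[OF P] and inj = partition_on_carrier(5)[OF P]
    and key = sum_set_mats[OF P]
  show ?thesis
  proof (intro equalityI subsetI)
    fix M assume "M \<in> span_over K (set_mat G ` P)"
    then obtain k where k: "\<forall>X\<in>set_mat G ` P. k X \<in> K" "M = (\<lambda>a b. \<Sum>X\<in>set_mat G ` P. k X * X a b)"
      by (auto simp: span_over_def)
    define c where "c g = k (set_mat G (THE D. D \<in> P \<and> g \<in> D))" for g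
    have c: "c g = k (set_mat G D)" if "D \<in> P" "g \<in> D" for D g
    proof -
      have "(THE D. D \<in> P \<and> g \<in> D) = D" using that uniq by (intro the_equality) auto
      then show ?thesis by (simp add: c_def)
    qed
    have "\<forall>g\<in>carrier G. c g \<in> K" using ex1 c k(1) by fastforce
    moreover have "\<forall>D\<in>P. \<forall>g\<in>D. \<forall>h\<in>D. c g = c h" using c by auto
    ultimately show "M \<in> {cayley_mat G c | c. (\<forall>g\<in>carrier G. c g \<in> K) \<and> (\<forall>D\<in>P. \<forall>g\<in>D. \<forall>h\<in>D. c g = c h)}"
      using key[of c k, OF c] k(2) by blast
  next
    fix M assume "M \<in> {cayley_mat G c | c. (\<forall>g\<in>carrier G. c g \<in> K) \<and> (\<forall>D\<in>P. \<forall>g\<in>D. \<forall>h\<in>D. c g = c h)}"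
    then obtain c where c: "M = cayley_mat G c" "\<forall>g\<in>carrier G. c g \<in> K"
      "\<forall>D\<in>P. \<forall>g\<in>D. \<forall>h\<in>D. c g = c h" by blast
    \<comment> \<open>Recovers the block from its matrix and evaluates \<open>c\<close> at some
      element of it; the choice is immaterial because \<open>c\<close> is constant there.\<close>
    define k where "k X = c (SOME g. g \<in> inv_into P (set_mat G) X)" for X
    have k: "k (set_mat G D) = c g" if "D \<in> P" "g \<in> D" for D g
    proof -
      have "inv_into P (set_mat G) (set_mat G D) = D" using inj that by simp
      moreover have "(SOME g. g \<in> D) \<in> D" using that(2) by (rule someI)
      ultimately show ?thesis using c(3) that unfolding k_def by metis
    qed
    have "k (set_mat G D) \<in> K" if D: "D \<in> P" for D
    proof -
      obtain g where "g \<in> D" using P D by (metis partition_on_def all_not_in_conv)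
      then show ?thesis using k[OF D] c(2) sub[OF D] by auto
    qed
    then show "M \<in> span_over K (set_mat G ` P)"
      unfolding span_over_def c(1) using key[of c k] k by (intro CollectI exI[of _ k]) auto
  qed
qed

end

lemma partition_on_classes:
  assumes refl: "\<And>g. g \<in> A \<Longrightarrow> R g g"
    and sym: "\<And>g h. g \<in> A \<Longrightarrow> h \<in> A \<Longrightarrow> R g h \<Longrightarrow> R h g"
    and trans: "\<And>g h k. g \<in> A \<Longrightarrow> h \<in> A \<Longrightarrow> k \<in> A \<Longrightarrow> R g h \<Longrightarrow> R h k \<Longrightarrow> R g k"
  shows "partition_on A ((\<lambda>g. {h \<in> A. R h g}) ` A)"
proof (rule partition_onI)
  show "\<Union> ((\<lambda>g. {h \<in> A. R h g}) ` A) = A" using refl by blast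
next
  fix p q assume "p \<in> (\<lambda>g. {h \<in> A. R h g}) ` A" "q \<in> (\<lambda>g. {h \<in> A. R h g}) ` A" "p \<noteq> q"
  then obtain g h where gh: "g \<in> A" "h \<in> A" "p = {x \<in> A. R x g}" "q = {x \<in> A. R x h}" by blast
  have "R g h" if "x \<in> p" "x \<in> q" for x
    using that gh sym[of x g] trans[of g x h] by blast
  moreover have "p = q" if "R g h"
    using that gh sym[OF gh(1,2) that] trans[of _ g h] trans[of _ h g] by blast
  ultimately show "disjnt p q" using \<open>p \<noteq> q\<close> by (auto simp: disjnt_def)
next
  show "{} \<notin> (\<lambda>g. {h \<in> A. R h g}) ` A" using refl by blast
qed

section \<open>F-conjugacy\<close>

lemma field_aut_sum:
  assumes L: "is_subfield L" and \<sigma>: "field_aut L \<sigma>" and f: "\<And>i. i \<in> A \<Longrightarrow> f i \<in> L"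
  shows "\<sigma> (sum f A) = (\<Sum>i\<in>A. \<sigma> (f i))"
proof -
  have "\<sigma> (0 + 0) = \<sigma> 0 + \<sigma> 0"
    using \<sigma> subfield_0[OF L] unfolding field_aut_def by blast
  then have "\<sigma> 0 = 0" by simp
  then show ?thesis using f
  proof (induction A rule: infinite_finite_induct)
    case (insert x A)
    have "\<sigma> (f x + sum f A) = \<sigma> (f x) + \<sigma> (sum f A)"
      using insert.prems \<sigma> subfield_sum[OF L, of A f] unfolding field_aut_def by simp
    then show ?case using insert by simp
  qed simp_all
qed

section \<open>Automorphisms over \<open>F\<close> and the group of exponents
  \<open>ZF\<close>\<close>

locale galois_group = finite_group +
  fixes F :: "complex set"
  assumes F: "is_subfield F" and F_subset: "F \<subseteq> cyclo_field (group_exponent G)"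
begin

abbreviation "e \<equiv> group_exponent G"
abbreviation "\<zeta> \<equiv> zeta e"
abbreviation "L \<equiv> cyclo_field e"

lemma L: "is_subfield L"
  by (simp add: cyclo_field_def is_subfield_gen_field)

lemma zeta_in_L: "\<zeta> \<in> L"
  by (simp add: cyclo_field_def gen_field_def)

lemma ZF_obtain:
  assumes "k \<in> ZF G F"
  obtains \<sigma> where "field_aut L \<sigma>" "\<sigma> \<zeta> = \<zeta> ^ k" "\<And>x. x \<in> F \<Longrightarrow> \<sigma> x = x"
  using assms unfolding ZF_def by blast

lemma aut_zeta_power:
  assumes \<sigma>: "field_aut L \<sigma>" "\<sigma> \<zeta> = \<zeta> ^ k" "\<And>x. x \<in> F \<Longrightarrow> \<sigma> x = x"
  shows "\<sigma> (\<zeta> ^ j) = \<zeta> ^ (j * k)"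
proof (induction j)
  case 0
  show ?case using \<sigma>(3) subfield_1[OF F] by simp
next
  case (Suc j)
  have "\<sigma> (\<zeta> * \<zeta> ^ j) = \<sigma> \<zeta> * \<sigma> (\<zeta> ^ j)"
    using \<sigma>(1) zeta_in_L subfield_power[OF L zeta_in_L] unfolding field_aut_def by blast
  then show ?case using Suc \<sigma>(2) by (simp add: power_add)
qed

text \<open>The meeting point of both actions: on such a sum the automorphism does what replacing
  \<open>A_g\<close> by \<open>A_g ^ k\<close> does to the trace formula.\<close>

lemma aut_zeta_sum:
  assumes \<sigma>: "field_aut L \<sigma>" "\<sigma> \<zeta> = \<zeta> ^ k" "\<And>x. x \<in> F \<Longrightarrow> \<sigma> x = x"
    and s: "\<And>j. j \<in> A \<Longrightarrow> s j \<in> F"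
  shows "\<sigma> (\<Sum>j\<in>A. \<zeta> ^ j * s j) = (\<Sum>j\<in>A. \<zeta> ^ (j * k) * s j)"
proof -
  have "\<zeta> ^ j * s j \<in> L" if "j \<in> A" for j
    using s[OF that] F_subset L zeta_in_L by (auto intro: subfield_mult subfield_power)
  then have "\<sigma> (\<Sum>j\<in>A. \<zeta> ^ j * s j) = (\<Sum>j\<in>A. \<sigma> (\<zeta> ^ j * s j))"
    by (intro field_aut_sum[OF L \<sigma>(1)])
  also have "\<dots> = (\<Sum>j\<in>A. \<zeta> ^ (j * k) * s j)"
  proof (rule sum.cong)
    fix j assume j: "j \<in> A"
    have "\<sigma> (\<zeta> ^ j * s j) = \<sigma> (\<zeta> ^ j) * \<sigma> (s j)"
      using \<sigma>(1) subfield_power[OF L zeta_in_L, of j] s[OF j] F_subset unfolding field_aut_def by blast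
    then show "\<sigma> (\<zeta> ^ j * s j) = \<zeta> ^ (j * k) * s j"
      using \<sigma>(3) s[OF j] aut_zeta_power[OF \<sigma>] by simp
  qed simp
  finally show ?thesis .
qed

lemma ZF_coprime: "k \<in> ZF G F \<Longrightarrow> coprime k e"
  by (simp add: ZF_def units_mod_def)

text \<open>Written \<open>1 mod e\<close> because of the trivial group: for exponent 1 the only
  residue in \<open>units_mod\<close> is 0.\<close>

lemma ZF_one: "1 mod e \<in> ZF G F"
proof -
  have "coprime (1 mod e) e"
    by (metis coprime_1_left coprime_mod_left_iff group_exponent_pos not_gr_zero)
  moreover have "\<zeta> ^ (1 mod e) = \<zeta>"
    using zeta_power_mod[OF group_exponent_pos, of 1] by (simp only: power_one_right)
  moreover have "field_aut L (\<lambda>x. x)" by (simp add: field_aut_def flip: id_def)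
  ultimately show ?thesis
    unfolding ZF_def units_mod_def using group_exponent_pos by (auto intro!: exI[of _ "\<lambda>x. x"])
qed

lemma ZF_mult:
  assumes "k \<in> ZF G F" "l \<in> ZF G F"
  shows "k * l mod e \<in> ZF G F"
proof -
  obtain \<sigma> where \<sigma>: "field_aut L \<sigma>" "\<sigma> \<zeta> = \<zeta> ^ k" "\<And>x. x \<in> F \<Longrightarrow> \<sigma> x = x"
    using ZF_obtain[OF assms(1)] by blast
  obtain \<tau> where \<tau>: "field_aut L \<tau>" "\<tau> \<zeta> = \<zeta> ^ l" "\<And>x. x \<in> F \<Longrightarrow> \<tau> x = x"
    using ZF_obtain[OF assms(2)] by blast
  have \<tau>L: "\<tau> x \<in> L" if "x \<in> L" for x
    using \<tau>(1) that by (auto simp: field_aut_def bij_betw_def)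
  have "field_aut L (\<sigma> \<circ> \<tau>)"
    using \<sigma>(1) \<tau>(1) \<tau>L unfolding field_aut_def by (auto intro: bij_betw_trans)
  moreover have "(\<sigma> \<circ> \<tau>) \<zeta> = \<zeta> ^ (k * l mod e)"
    using \<tau>(2) aut_zeta_power[OF \<sigma>, of l] zeta_power_mod[OF group_exponent_pos]
    by (simp add: mult.commute)
  moreover have "\<forall>x\<in>F. (\<sigma> \<circ> \<tau>) x = x" using \<sigma>(3) \<tau>(3) by simp
  moreover have "coprime (k * l mod e) e"
    using ZF_coprime[OF assms(1)] ZF_coprime[OF assms(2)] group_exponent_pos by simp
  moreover have "k * l mod e < e" using group_exponent_pos by simp
  ultimately show ?thesis
    unfolding ZF_def units_mod_def by blast
qed

lemma ZF_power: "k \<in> ZF G F \<Longrightarrow> k ^ m mod e \<in> ZF G F"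
proof (induction m)
  case 0
  show ?case using ZF_one by simp
next
  case (Suc m)
  then show ?case using ZF_mult[of k "k ^ m mod e"] by (simp add: mod_mult_right_eq)
qed

text \<open>By Euler's theorem an inverse is a power, so closure under products is enough and no
  inverse automorphism has to be constructed.\<close>

lemma ZF_inverse:
  assumes "k \<in> ZF G F"
  shows "\<exists>l\<in>ZF G F. [k * l = 1] (mod e)"
proof (intro bexI)
  have "[k ^ totient e = 1] (mod e)" using ZF_coprime[OF assms] by (rule euler_theorem)
  moreover have "totient e > 0" using group_exponent_pos by simp
  then have "k * k ^ (totient e - 1) = k ^ totient e" by (simp flip: power_Suc)
  ultimately show "[k * (k ^ (totient e - 1) mod e) = 1] (mod e)"
    by (simp add: cong_def mod_mult_right_eq)
  show "k ^ (totient e - 1) mod e \<in> ZF G F" using assms by (rule ZF_power)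
qed

text \<open>Serves to reindex sums over the group. In a nonabelian group the map need not respect
  products, but raising to an inverse exponent undoes it.\<close>

lemma bij_betw_pow:
  assumes "k \<in> ZF G F"
  shows "bij_betw (\<lambda>g. g [^] k) (carrier G) (carrier G)"
proof -
  obtain l where l: "[k * l = 1] (mod e)" using ZF_inverse[OF assms] by blast
  have *: "g [^] (k * l) = g" if "g \<in> carrier G" for g
    using pow_cong_exponent[OF that l] that by simp
  show ?thesis
    by (rule bij_betw_byWitness[where f' = "\<lambda>g. g [^] l"])
      (auto simp: nat_pow_pow * mult.commute[of l])
qed

section \<open>Conjugacy and \<open>simF\<close> as equivalence relations, and the spans of their
  classes\<close>

lemma conjugate_mult:
  assumes "x \<in> carrier G" "y \<in> carrier G" "g \<in> carrier G"
  shows "x \<otimes> (y \<otimes> g \<otimes> inv y) \<otimes> inv x = (x \<otimes> y) \<otimes> g \<otimes> inv (x \<otimes> y)"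
  using assms by (simp add: m_assoc inv_mult_group)

lemma simF_I:
  assumes "x \<in> carrier G" "h \<in> carrier G" "k \<in> ZF G F"
  shows "simF G F (x \<otimes> h [^] k \<otimes> inv x) h"
  using assms unfolding simF_def Defs.conjugate_def by auto

lemma simF_E:
  assumes "simF G F g h"
  obtains x k where "g \<in> carrier G" "h \<in> carrier G" "x \<in> carrier G" "k \<in> ZF G F"
    "g = x \<otimes> h [^] k \<otimes> inv x"
  using assms unfolding simF_def Defs.conjugate_def by auto

lemma simF_refl:
  assumes "g \<in> carrier G"
  shows "simF G F g g"
  using simF_I[OF one_closed assms ZF_one] pow_mod_exponent[OF assms, of 1] assms by simp

text \<open>Powers commute with conjugation, so raising \<open>g\<close> to the inverse exponent
  turns \<open>h ^ k\<close> back into \<open>h\<close>.\<close>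

lemma simF_sym:
  assumes "simF G F g h"
  shows "simF G F h g"
proof -
  obtain x k where xk: "g \<in> carrier G" "h \<in> carrier G" "x \<in> carrier G" "k \<in> ZF G F"
    "g = x \<otimes> h [^] k \<otimes> inv x" using assms by (rule simF_E)
  obtain l where l: "l \<in> ZF G F" "[k * l = 1] (mod e)" using ZF_inverse[OF xk(4)] by blast
  have "g [^] l = x \<otimes> h [^] (k * l) \<otimes> inv x"
    using xk by (simp add: conjugate_pow nat_pow_pow)
  also have "h [^] (k * l) = h" using pow_cong_exponent[OF xk(2) l(2)] xk(2) by simp
  finally have "inv x \<otimes> g [^] l \<otimes> inv (inv x) = h"
    using xk by (simp add: m_assoc)
  then show ?thesis using simF_I[of "inv x" g l] xk l by simp
qed

lemma simF_trans:
  assumes "simF G F g h" "simF G F h m"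
  shows "simF G F g m"
proof -
  obtain x k where xk: "g \<in> carrier G" "h \<in> carrier G" "x \<in> carrier G" "k \<in> ZF G F"
    "g = x \<otimes> h [^] k \<otimes> inv x" using assms(1) by (rule simF_E)
  obtain y l where yl: "m \<in> carrier G" "y \<in> carrier G" "l \<in> ZF G F"
    "h = y \<otimes> m [^] l \<otimes> inv y" using assms(2) by (rule simF_E)
  have "g = x \<otimes> (y \<otimes> m [^] (l * k) \<otimes> inv y) \<otimes> inv x"
    using xk yl by (simp add: conjugate_pow nat_pow_pow)
  also have "\<dots> = (x \<otimes> y) \<otimes> m [^] (l * k mod e) \<otimes> inv (x \<otimes> y)"
    using xk yl by (simp add: conjugate_mult pow_mod_exponent)
  finally show ?thesis using simF_I[of "x \<otimes> y" m "l * k mod e"] ZF_mult[OF yl(3) xk(4)] xk yl by simp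
qed

lemma conj_class_eq: "g \<in> carrier G \<Longrightarrow> conj_class G g = {h \<in> carrier G. Defs.conjugate G h g}"
  unfolding conj_class_def Defs.conjugate_def by auto

lemma partition_conj_classes: "partition_on (carrier G) (conj_classes G)"
proof -
  have "conj_classes G = (\<lambda>g. {h \<in> carrier G. Defs.conjugate G h g}) ` carrier G"
    unfolding conj_classes_def by (rule image_cong) (auto simp: conj_class_eq)
  also have "partition_on (carrier G) \<dots>"
  proof (rule partition_on_classes)
    fix g assume "g \<in> carrier G"
    then show "Defs.conjugate G g g" unfolding Defs.conjugate_def by (intro bexI[of _ \<one>]) auto
  next
    fix g h assume gh: "g \<in> carrier G" "h \<in> carrier G" "Defs.conjugate G g h"
    then obtain x where x: "x \<in> carrier G" "g = x \<otimes> h \<otimes> inv x" unfolding Defs.conjugate_def by blast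
    then have "h = inv x \<otimes> g \<otimes> inv (inv x)" using gh by (simp add: m_assoc)
    then show "Defs.conjugate G h g" unfolding Defs.conjugate_def using x by blast
  next
    fix g h m assume ghm: "g \<in> carrier G" "h \<in> carrier G" "m \<in> carrier G"
      "Defs.conjugate G g h" "Defs.conjugate G h m"
    then obtain x y where "x \<in> carrier G" "g = x \<otimes> h \<otimes> inv x" "y \<in> carrier G" "h = y \<otimes> m \<otimes> inv y"
      unfolding Defs.conjugate_def by blast
    then show "Defs.conjugate G g m" unfolding Defs.conjugate_def using ghm conjugate_mult by blast
  qed
  finally show ?thesis .
qed

lemma partition_simF_classes: "partition_on (carrier G) (simF_classes G F)"
  unfolding simF_classes_def simF_class_def
  by (rule partition_on_classes) (auto intro: simF_refl simF_sym simF_trans)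

lemma const_on_conj_classes_iff:
  "(\<forall>D\<in>conj_classes G. \<forall>g\<in>D. \<forall>h\<in>D. c g = c h) \<longleftrightarrow> class_fun G c"
proof
  assume *: "\<forall>D\<in>conj_classes G. \<forall>g\<in>D. \<forall>h\<in>D. c g = c h"
  show "class_fun G c" unfolding class_fun_def
  proof (intro ballI)
    fix g x assume g: "g \<in> carrier G" and x: "x \<in> carrier G"
    have "x \<otimes> g \<otimes> inv x \<in> conj_class G g" using g x by (auto simp: conj_class_def)
    moreover have "g \<in> conj_class G g"
      unfolding conj_class_def using g by (intro CollectI exI[of _ \<one>]) simp
    moreover have "conj_class G g \<in> conj_classes G" using g by (simp add: conj_classes_def)
    ultimately show "c (x \<otimes> g \<otimes> inv x) = c g" using * by blast
  qed
next
  assume *: "class_fun G c"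
  show "\<forall>D\<in>conj_classes G. \<forall>g\<in>D. \<forall>h\<in>D. c g = c h"
    using * unfolding conj_classes_def conj_class_def class_fun_def by auto
qed

text \<open>The relation is generated by conjugation, which is the exponent \<open>1 mod e\<close>,
  and by the power maps, which is conjugation by the identity. Invariance under both is therefore
  constancy on classes.\<close>

lemma const_on_simF_classes_iff:
  "(\<forall>D\<in>simF_classes G F. \<forall>g\<in>D. \<forall>h\<in>D. c g = c h) \<longleftrightarrow>
     class_fun G c \<and> (\<forall>k\<in>ZF G F. \<forall>g\<in>carrier G. c (g [^] k) = c g)"
proof
  assume *: "\<forall>D\<in>simF_classes G F. \<forall>g\<in>D. \<forall>h\<in>D. c g = c h"
  have eq: "c g = c h" if gh: "simF G F g h" for g h
  proof -
    have "g \<in> carrier G" "h \<in> carrier G" using gh by (auto simp: simF_def)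
    then have "g \<in> simF_class G F h" "h \<in> simF_class G F h" "simF_class G F h \<in> simF_classes G F"
      using gh simF_refl by (auto simp: simF_class_def simF_classes_def)
    then show ?thesis using * by blast
  qed
  have "c (x \<otimes> g \<otimes> inv x) = c g" if "g \<in> carrier G" "x \<in> carrier G" for g x
    using eq[OF simF_I[OF that(2,1) ZF_one]] that pow_mod_exponent[OF that(1), of 1] by simp
  moreover have "c (g [^] k) = c g" if "k \<in> ZF G F" "g \<in> carrier G" for k g
    using eq[OF simF_I[OF one_closed that(2,1)]] that by simp
  ultimately show "class_fun G c \<and> (\<forall>k\<in>ZF G F. \<forall>g\<in>carrier G. c (g [^] k) = c g)"
    by (auto simp: class_fun_def)
next
  assume *: "class_fun G c \<and> (\<forall>k\<in>ZF G F. \<forall>g\<in>carrier G. c (g [^] k) = c g)"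
  have eq: "c g = c h" if gh: "simF G F g h" for g h
    using gh * by (auto elim!: simF_E simp: class_fun_def)
  show "\<forall>D\<in>simF_classes G F. \<forall>g\<in>D. \<forall>h\<in>D. c g = c h"
    using eq by (auto simp: simF_classes_def simF_class_def)
qed

lemma span_class_scheme:
  "span_over K (class_scheme G) = {cayley_mat G c | c. (\<forall>g\<in>carrier G. c g \<in> K) \<and> class_fun G c}"
  unfolding class_scheme_def span_over_set_mats[OF partition_conj_classes] const_on_conj_classes_iff ..

lemma span_B_mats:
  "span_over K (B_mats G F) = {cayley_mat G c | c. (\<forall>g\<in>carrier G. c g \<in> K) \<and> class_fun G c \<and>
     (\<forall>k\<in>ZF G F. \<forall>g\<in>carrier G. c (g [^] k) = c g)}"
  unfolding B_mats_def span_over_set_mats[OF partition_simF_classes] const_on_simF_classes_iff ..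

lemma trace_cayley_perm_powers:
  assumes c: "class_fun G c" and g: "g \<in> carrier G"
  shows "\<exists>es. (\<forall>j<e. \<forall>x\<in>set (es j). x = 0 \<or> mat_eigenvalue (carrier G) (cayley_mat G c) x) \<and>
          (\<forall>m k. mat_trace (carrier G) (mat_mult (carrier G)
               (mat_pow (carrier G) (cayley_mat G c) (Suc m)) (perm_mat G (g [^] k)))
             = (\<Sum>j<e. \<zeta> ^ (j * k) * (\<Sum>x\<leftarrow>es j. x ^ Suc m)))"
proof -
  have "mat_mult (carrier G) (cayley_mat G c) (perm_mat G g)
      = mat_mult (carrier G) (perm_mat G g) (cayley_mat G c)"
    using cayley_mat_commute[OF c] by (simp add: perm_mat_eq_cayley)
  moreover have "mat_on (carrier G) (perm_mat G g)" by (simp add: perm_mat_eq_cayley)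
  moreover have "mat_pow (carrier G) (perm_mat G g) e = id_mat (carrier G)"
    using g by (simp add: mat_pow_perm pow_group_exponent id_mat_eq_perm)
  ultimately show ?thesis
    using trace_mult_finite_order[OF finite_carrier group_exponent_pos, of "perm_mat G g" "cayley_mat G c"]
    by (simp only: mat_pow_perm[OF g] mat_on_cayley)
qed

lemma eigenvalues_in_F_imp_pow_invariant:
  assumes c: "class_fun G c" "\<And>g. g \<in> carrier G \<Longrightarrow> c g \<in> F"
    and ev: "\<And>mu. mat_eigenvalue (carrier G) (cayley_mat G c) mu \<Longrightarrow> mu \<in> F"
    and k: "k \<in> ZF G F" and g: "g \<in> carrier G"
  shows "c (g [^] k) = c g"
proof -
  \<comment> \<open>The formula is taken at \<open>inv g\<close> since the trace against
    \<open>A_h\<close> returns the coefficient at \<open>inv h\<close>.\<close>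
  obtain es where es: "\<And>j x. j < e \<Longrightarrow> x \<in> set (es j) \<Longrightarrow> x = 0 \<or> mat_eigenvalue (carrier G) (cayley_mat G c) x"
    and tr: "\<And>m k. mat_trace (carrier G) (mat_mult (carrier G)
               (mat_pow (carrier G) (cayley_mat G c) (Suc m)) (perm_mat G (inv g [^] k)))
             = (\<Sum>j<e. \<zeta> ^ (j * k) * (\<Sum>x\<leftarrow>es j. x ^ Suc m))"
    using trace_cayley_perm_powers[OF c(1) inv_closed[OF g]] by blast
  define s where "s j = (\<Sum>x\<leftarrow>es j. x)" for j
  have s: "s j \<in> F" if "j < e" for j
    unfolding s_def using es[OF that] ev subfield_0[OF F] by (intro subfield_sum_list[OF F]) auto
  have tr': "of_nat (card (carrier G)) * c (g [^] i) = (\<Sum>j<e. \<zeta> ^ (j * i) * s j)" for i :: nat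
  proof -
    have "mat_pow (carrier G) (cayley_mat G c) (Suc 0) = cayley_mat G c" by simp
    then have "mat_trace (carrier G) (mat_mult (carrier G) (cayley_mat G c) (perm_mat G (inv g [^] i)))
        = (\<Sum>j<e. \<zeta> ^ (j * i) * s j)"
      using tr[of 0 i] by (simp only: s_def power_one_right flip: One_nat_def)
    moreover have "inv (inv g [^] i) = g [^] i" using g by (simp add: nat_pow_inv)
    ultimately show ?thesis using g by (simp add: mat_trace_cayley_perm)
  qed
  obtain \<sigma> where \<sigma>: "field_aut L \<sigma>" "\<sigma> \<zeta> = \<zeta> ^ k" "\<And>x. x \<in> F \<Longrightarrow> \<sigma> x = x"
    using ZF_obtain[OF k] by blast
  have "of_nat (card (carrier G)) * c g \<in> F"
    using F c(2)[OF g] by (intro subfield_mult subfield_of_nat)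
  then have "of_nat (card (carrier G)) * c g = \<sigma> (of_nat (card (carrier G)) * c g)"
    using \<sigma>(3) by simp
  also have "\<dots> = \<sigma> (\<Sum>j<e. \<zeta> ^ j * s j)" using tr'[of 1] g by simp
  also have "\<dots> = (\<Sum>j<e. \<zeta> ^ (j * k) * s j)" using s by (intro aut_zeta_sum[OF \<sigma>]) auto
  also have "\<dots> = of_nat (card (carrier G)) * c (g [^] k)" by (rule tr'[symmetric])
  finally show ?thesis using card_carrier_pos by auto
qed

end

section \<open>Eigenvalues and the subscheme\<close>

lemma sum_list_sum_swap:
  fixes a :: "'i \<Rightarrow> complex"
  shows "(\<Sum>x\<leftarrow>xs. \<Sum>i\<in>A. a i * h i x) = (\<Sum>i\<in>A. a i * (\<Sum>x\<leftarrow>xs. h i x))"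
  by (induction xs) (simp_all add: sum.distrib distrib_left)

text \<open>Interpolation by a polynomial \<open>x f(x)\<close> without constant term, possible
  because \<open>mu\<close> is nonzero. A zero in \<open>X\<close> is sent to 0 whatever
  \<open>f\<close> is.\<close>

lemma ex_selecting_poly:
  fixes mu :: complex
  assumes "finite X" "mu \<noteq> 0"
  shows "\<exists>f. mu * poly f mu = 1 \<and> (\<forall>x\<in>X. x \<noteq> mu \<longrightarrow> x * poly f x = 0)"
proof -
  define q where "q = (\<Prod>x\<in>X - {mu}. [:- x, 1:])"
  have v: "mu * poly q mu \<noteq> 0" using assms by (auto simp: q_def poly_prod)
  show ?thesis
  proof (intro exI[of _ "smult (1 / (mu * poly q mu)) q"] conjI ballI impI)
    show "mu * poly (smult (1 / (mu * poly q mu)) q) mu = 1" using v by simp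
  next
    fix x assume "x \<in> X" "x \<noteq> mu"
    then have "poly q x = 0" using assms by (auto simp: q_def poly_prod intro!: bexI[of _ x])
    then show "x * poly (smult (1 / (mu * poly q mu)) q) x = 0" by simp
  qed
qed

text \<open>With \<open>s\<close> a square root of \<open>mu\<close>, the product
  \<open>(M - s)(M + s)\<close> kills \<open>v\<close>. Either \<open>(M + s) v\<close> is an
  eigenvector for \<open>s\<close>, or it is zero and \<open>v\<close> is one for
  \<open>-s\<close>.\<close>

lemma mat_eigenvalue_square:
  assumes "mat_eigenvalue I (mat_mult I M M) mu"
  shows "\<exists>s. s * s = mu \<and> mat_eigenvalue I M s"
proof -
  obtain v where v: "\<exists>a\<in>I. v a \<noteq> 0" "\<And>a. a \<in> I \<Longrightarrow> (\<Sum>b\<in>I. mat_mult I M M a b * v b) = mu * v a"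
    using assms unfolding mat_eigenvalue_def by blast
  define s where "s = csqrt mu"
  have s: "s * s = mu" by (simp add: s_def flip: power2_eq_square)
  define Mv where "Mv a = (\<Sum>b\<in>I. M a b * v b)" for a
  have MMv: "(\<Sum>b\<in>I. M a b * Mv b) = mu * v a" if a: "a \<in> I" for a
  proof -
    have "(\<Sum>b\<in>I. M a b * Mv b) = (\<Sum>c\<in>I. \<Sum>b\<in>I. M a c * (M c b * v b))"
      by (simp add: Mv_def sum_distrib_left)
    also have "\<dots> = (\<Sum>b\<in>I. \<Sum>c\<in>I. M a c * (M c b * v b))" by (rule sum.swap)
    also have "\<dots> = (\<Sum>b\<in>I. mat_mult I M M a b * v b)"
      using a by (simp add: mat_mult_def sum_distrib_right mult.assoc)
    finally show ?thesis using v(2)[OF a] by simp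
  qed
  show ?thesis
  proof (cases "\<exists>a\<in>I. Mv a + s * v a \<noteq> 0")
    case True
    have "(\<Sum>b\<in>I. M a b * (Mv b + s * v b)) = s * (Mv a + s * v a)" if a: "a \<in> I" for a
    proof -
      have "(\<Sum>b\<in>I. M a b * (Mv b + s * v b)) = (\<Sum>b\<in>I. M a b * Mv b) + s * Mv a"
        by (simp add: Mv_def distrib_left sum.distrib sum_distrib_left mult_ac)
      then show ?thesis using MMv[OF a] s by (simp add: distrib_left mult.assoc[symmetric])
    qed
    then have "mat_eigenvalue I M s" unfolding mat_eigenvalue_def
      using True by (intro exI[of _ "\<lambda>a. Mv a + s * v a"]) auto
    then show ?thesis using s by blast
  next
    case False
    then have "Mv a = - s * v a" if "a \<in> I" for a
      using that by (simp add: eq_neg_iff_add_eq_0)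
    then have "mat_eigenvalue I M (- s)" unfolding mat_eigenvalue_def Mv_def
      using v(1) by (intro exI[of _ v]) auto
    then show ?thesis using s by (intro exI[of _ "- s"]) simp
  qed
qed

lemma union_of_blocks_iff:
  assumes P: "partition_on A P" and C: "C \<subseteq> A"
  shows "(\<exists>Q\<subseteq>P. C = \<Union>Q) \<longleftrightarrow> (\<forall>D\<in>P. \<forall>g\<in>D. \<forall>h\<in>D. g \<in> C \<longleftrightarrow> h \<in> C)"
proof
  assume "\<exists>Q\<subseteq>P. C = \<Union>Q"
  then obtain Q where Q: "Q \<subseteq> P" "C = \<Union>Q" by blast
  have "D \<in> Q" if g: "D \<in> P" "g \<in> D" "g \<in> C" for D g
  proof -
    obtain E where "E \<in> Q" "g \<in> E" using g Q by blast
    then have "D = E" using P Q g by (auto simp: partition_on_def disjoint_def)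
    then show ?thesis using \<open>E \<in> Q\<close> by simp
  qed
  then show "\<forall>D\<in>P. \<forall>g\<in>D. \<forall>h\<in>D. g \<in> C \<longleftrightarrow> h \<in> C" using Q by blast
next
  assume *: "\<forall>D\<in>P. \<forall>g\<in>D. \<forall>h\<in>D. g \<in> C \<longleftrightarrow> h \<in> C"
  have "C = \<Union>{D\<in>P. D \<inter> C \<noteq> {}}"
  proof (intro equalityI subsetI)
    fix g assume g: "g \<in> C"
    then obtain D where "D \<in> P" "g \<in> D" using P C by (auto simp: partition_on_def)
    then show "g \<in> \<Union>{D\<in>P. D \<inter> C \<noteq> {}}" using g by blast
  next
    fix g assume "g \<in> \<Union>{D\<in>P. D \<inter> C \<noteq> {}}"
    then show "g \<in> C" using * by blast
  qed
  then show "\<exists>Q\<subseteq>P. C = \<Union>Q" by (intro exI[of _ "{D\<in>P. D \<inter> C \<noteq> {}}"]) auto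
qed

section \<open>Eigenvalues of power-invariant class functions\<close>

context galois_group
begin

text \<open>Invariance replaces \<open>c g\<close> by \<open>c (g^k)\<close>, after which the power
  map only permutes the summands. The right-hand side does not mention \<open>k\<close>.\<close>

lemma sum_trace_cayley_perm:
  assumes inv: "\<And>g. g \<in> carrier G \<Longrightarrow> c (g [^] k) = c g"
    and bij: "bij_betw (\<lambda>g. g [^] k) (carrier G) (carrier G)"
  shows "(\<Sum>g\<in>carrier G. c g * mat_trace (carrier G) (mat_mult (carrier G) X (perm_mat G (g [^] (k::nat)))))
       = mat_trace (carrier G) (mat_mult (carrier G) X (cayley_mat G c))"
proof -
  let ?t = "\<lambda>g. mat_trace (carrier G) (mat_mult (carrier G) X (perm_mat G g))"
  have "(\<Sum>g\<in>carrier G. c g * ?t (g [^] k)) = (\<Sum>g\<in>carrier G. c (g [^] k) * ?t (g [^] k))"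
    using inv by simp
  also have "\<dots> = (\<Sum>g\<in>carrier G. c g * ?t g)"
    by (rule sum.reindex_bij_betw[OF bij])
  also have "\<dots> = mat_trace (carrier G) (mat_mult (carrier G) X (cayley_mat G c))"
    by (simp only: cayley_mat_eq_sum mat_mult_sum_right mat_trace_sum)
  finally show ?thesis .
qed

lemma pow_invariant_imp_eigenvalues_in_F:
  assumes c: "class_fun G c" "\<And>g. g \<in> carrier G \<Longrightarrow> c g \<in> F"
    and inv: "\<And>k g. k \<in> ZF G F \<Longrightarrow> g \<in> carrier G \<Longrightarrow> c (g [^] k) = c g"
    and ev: "mat_eigenvalue (carrier G) (cayley_mat G c) mu"
  shows "mu \<in> F"
proof (cases "mu = 0")
  case True
  then show ?thesis using subfield_0[OF F] by simp
next
  case False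
  define I where "I = carrier G"
  define M where "M = cayley_mat G c"
  have "finite I" by (simp add: I_def)
  then obtain ms where ms: "set ms = {x. mat_eigenvalue I M x}"
    "\<And>m. mat_trace I (mat_pow I M m) = (\<Sum>x\<leftarrow>ms. x ^ m)"
    using trace_powers_eigenvalues by blast
  have "\<forall>g\<in>I. \<exists>es. \<forall>m k. mat_trace I (mat_mult I (mat_pow I M (Suc m)) (perm_mat G (g [^] k)))
             = (\<Sum>j<e. \<zeta> ^ (j * k) * (\<Sum>x\<leftarrow>es j. x ^ Suc m))"
    using trace_cayley_perm_powers[OF c(1)] unfolding I_def M_def by blast
  then obtain es where es: "\<And>g m k. g \<in> I \<Longrightarrow>
      mat_trace I (mat_mult I (mat_pow I M (Suc m)) (perm_mat G (g [^] (k::nat))))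
             = (\<Sum>j<e. \<zeta> ^ (j * k) * (\<Sum>x\<leftarrow>es g j. x ^ Suc m))"
    by metis
  \<comment> \<open>Every number occurring in one of the power sums, so that a single
    \<open>f\<close> isolates \<open>mu\<close> for all \<open>g\<close> and \<open>j\<close> at
    once.\<close>
  define X where "X = set ms \<union> (\<Union>g\<in>I. \<Union>j<e. set (es g j))"
  have "finite X" using \<open>finite I\<close> by (simp add: X_def)
  then obtain f where f: "mu * poly f mu = 1" "\<And>x. x \<in> X \<Longrightarrow> x \<noteq> mu \<Longrightarrow> x * poly f x = 0"
    using ex_selecting_poly[OF _ False] by blast
  define \<phi> where "\<phi> x = x * poly f x" for x
  have \<phi>: "\<phi> x = (if x = mu then 1 else 0)" if "x \<in> X" for x
    using f that by (auto simp: \<phi>_def)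
  have \<phi>_sum: "\<phi> x = (\<Sum>i\<le>degree f. coeff f i * x ^ Suc i)" for x
    by (simp add: \<phi>_def poly_altdef sum_distrib_left mult_ac)
  have sum_\<phi>: "(\<Sum>x\<leftarrow>xs. \<phi> x) = (\<Sum>i\<le>degree f. coeff f i * (\<Sum>x\<leftarrow>xs. x ^ Suc i))" for xs
    by (simp only: \<phi>_sum sum_list_sum_swap)
  \<comment> \<open>On \<open>X\<close> the function \<open>\<phi>\<close> is the indicator of
    \<open>mu\<close>, so this counts the occurrences of \<open>mu\<close> in \<open>es g j\<close>;
    the count lies in \<open>F\<close> although the list entries may not.\<close>
  define N where "N g j = (\<Sum>x\<leftarrow>es g j. \<phi> x)" for g j
  have N: "N g j \<in> F" if "g \<in> I" "j < e" for g j
    unfolding N_def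
  proof (rule subfield_sum_list[OF F])
    fix x assume "x \<in> set (es g j)"
    then have "x \<in> X" using that by (auto simp: X_def)
    then show "\<phi> x \<in> F" using \<phi> subfield_0[OF F] subfield_1[OF F] by simp
  qed
  \<comment> \<open>The algebraic multiplicity of \<open>mu\<close>, positive because
    \<open>mu\<close> is an eigenvalue; it can be divided out at the end.\<close>
  define r where "r = (\<Sum>x\<leftarrow>ms. \<phi> x)"
  have "r = of_nat (length (filter (\<lambda>x. x = mu) ms))"
  proof -
    have "(\<Sum>x\<leftarrow>xs. \<phi> x) = of_nat (length (filter (\<lambda>x. x = mu) xs))" if "set xs \<subseteq> X" for xs
      using that by (induction xs) (auto simp: \<phi>)
    then show ?thesis by (simp add: r_def X_def)
  qed
  moreover have "mu \<in> set ms" using ev by (simp add: ms I_def M_def)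
  then have "filter (\<lambda>x. x = mu) ms \<noteq> []" by (auto simp: filter_empty_conv)
  ultimately have r: "r \<in> F" "r \<noteq> 0" using subfield_of_nat[OF F] by auto
  have mu_r: "(\<Sum>x\<leftarrow>ms. x * \<phi> x) = mu * r"
  proof -
    have "(\<Sum>x\<leftarrow>ms. x * \<phi> x) = (\<Sum>x\<leftarrow>ms. mu * \<phi> x)"
      by (intro arg_cong[of _ _ sum_list] map_cong refl) (auto simp: \<phi> X_def)
    then show ?thesis by (simp add: r_def sum_list_const_mult)
  qed
  define S where "S j = (\<Sum>g\<in>I. c g * N g j)" for j
  have S: "S j \<in> F" if "j < e" for j
    unfolding S_def using N that c(2) by (intro subfield_sum[OF F] subfield_mult[OF F]) (auto simp: I_def)
  \<comment> \<open>The trace identities for all powers are combined with the coefficients of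
    \<open>f\<close>. On the left this produces the counts \<open>N\<close>; on the right the
    additional factor \<open>M\<close> gives \<Sum> x \<phi>(x) over the eigenvalues, which is
    \<open>mu * r\<close>.\<close>
  have key: "(\<Sum>j<e. \<zeta> ^ (j * k) * S j) = mu * r"
    if k: "\<And>g. g \<in> carrier G \<Longrightarrow> c (g [^] k) = c g"
      "bij_betw (\<lambda>g. g [^] k) (carrier G) (carrier G)" for k :: nat
  proof -
    let ?T = "\<lambda>i g. mat_trace I (mat_mult I (mat_pow I M (Suc i)) (perm_mat G (g [^] k)))"
    have T: "(\<Sum>j<e. \<zeta> ^ (j * k) * N g j) = (\<Sum>i\<le>degree f. coeff f i * ?T i g)" if "g \<in> I" for g
    proof -
      have "(\<Sum>j<e. \<zeta> ^ (j * k) * N g j)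
          = (\<Sum>j<e. \<Sum>i\<le>degree f. coeff f i * (\<zeta> ^ (j * k) * (\<Sum>x\<leftarrow>es g j. x ^ Suc i)))"
        by (simp only: N_def sum_\<phi> sum_distrib_left mult.left_commute)
      also have "\<dots> = (\<Sum>i\<le>degree f. \<Sum>j<e. coeff f i * (\<zeta> ^ (j * k) * (\<Sum>x\<leftarrow>es g j. x ^ Suc i)))"
        by (rule sum.swap)
      also have "\<dots> = (\<Sum>i\<le>degree f. coeff f i * ?T i g)"
        by (simp only: es[OF that] sum_distrib_left)
      finally show ?thesis .
    qed
    have "(\<Sum>j<e. \<zeta> ^ (j * k) * S j) = (\<Sum>j<e. \<Sum>g\<in>I. c g * (\<zeta> ^ (j * k) * N g j))"
      by (simp only: S_def sum_distrib_left mult.left_commute)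
    also have "\<dots> = (\<Sum>g\<in>I. \<Sum>j<e. c g * (\<zeta> ^ (j * k) * N g j))"
      by (rule sum.swap)
    also have "\<dots> = (\<Sum>g\<in>I. c g * (\<Sum>i\<le>degree f. coeff f i * ?T i g))"
      by (intro sum.cong refl) (simp only: T sum_distrib_left[symmetric])
    also have "\<dots> = (\<Sum>g\<in>I. \<Sum>i\<le>degree f. coeff f i * (c g * ?T i g))"
      by (simp only: sum_distrib_left mult.left_commute)
    also have "\<dots> = (\<Sum>i\<le>degree f. \<Sum>g\<in>I. coeff f i * (c g * ?T i g))"
      by (rule sum.swap)
    also have "\<dots> = (\<Sum>i\<le>degree f. coeff f i * (\<Sum>g\<in>I. c g * ?T i g))"
      by (simp only: sum_distrib_left)
    also have "\<dots> = (\<Sum>i\<le>degree f. coeff f i * mat_trace I (mat_pow I M (Suc (Suc i))))"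
      unfolding I_def M_def using sum_trace_cayley_perm[of c k, OF k] by simp
    also have "\<dots> = (\<Sum>x\<leftarrow>ms. \<Sum>i\<le>degree f. coeff f i * x ^ Suc (Suc i))"
      by (simp only: ms sum_list_sum_swap)
    also have "\<dots> = (\<Sum>x\<leftarrow>ms. x * \<phi> x)"
      by (simp only: \<phi>_sum sum_distrib_left power_Suc mult.left_commute)
    finally show ?thesis using mu_r by simp
  qed
  \<comment> \<open>The exponent 1 is treated on its own, since \<open>ZF\<close> contains 0 in its
    place when the group is trivial.\<close>
  have one: "(\<Sum>j<e. \<zeta> ^ j * S j) = mu * r"
  proof -
    have "bij_betw (\<lambda>g. g) (carrier G) (carrier G)" by (simp flip: id_def)
    then have "bij_betw (\<lambda>g. g [^] (1::nat)) (carrier G) (carrier G)"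
      by (rule bij_betw_cong[THEN iffD1, rotated]) simp
    then show ?thesis using key[of 1] by simp
  qed
  have "(\<Sum>j<e. \<zeta> ^ j * S j) \<in> L"
    using S F_subset by (intro subfield_sum[OF L] subfield_mult[OF L] subfield_power[OF L] zeta_in_L) auto
  then have "(mu * r) / r \<in> L" unfolding one using r F_subset by (intro subfield_divide[OF L]) auto
  then have mu: "mu \<in> L" using r by simp
  show ?thesis
  proof (rule fixed_field[OF F F_subset group_exponent_pos mu])
    fix \<sigma> k assume \<sigma>: "k \<in> units_mod e" "field_aut L \<sigma>" "\<sigma> \<zeta> = \<zeta> ^ k" "\<And>x. x \<in> F \<Longrightarrow> \<sigma> x = x"
    then have k: "k \<in> ZF G F" unfolding ZF_def by blast
    have "\<sigma> mu * r = \<sigma> mu * \<sigma> r" using \<sigma>(4) r by simp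
    also have "\<dots> = \<sigma> (mu * r)" using \<sigma>(2) mu r F_subset unfolding field_aut_def by auto
    also have "\<dots> = \<sigma> (\<Sum>j<e. \<zeta> ^ j * S j)" by (simp only: one)
    also have "\<dots> = (\<Sum>j<e. \<zeta> ^ (j * k) * S j)" using S by (intro aut_zeta_sum[OF \<sigma>(2-4)]) auto
    also have "\<dots> = mu * r" using inv[OF k] bij_betw_pow[OF k] by (rule key)
    finally show "\<sigma> mu = mu" using r by simp
  qed
qed

section \<open>The algebra of coefficient functions with values and eigenvalues in
  \<open>F\<close>\<close>

definition F_fun :: "('a \<Rightarrow> complex) \<Rightarrow> bool" where
  "F_fun c \<longleftrightarrow> (\<forall>g\<in>carrier G. c g \<in> F) \<and> class_fun G c \<and>
     (\<forall>k\<in>ZF G F. \<forall>g\<in>carrier G. c (g [^] k) = c g)"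

lemma span_F_B_mats: "span_over F (B_mats G F) = {cayley_mat G c | c. F_fun c}"
  by (simp only: span_B_mats F_fun_def)

lemma F_fun_iff_eigenvalues:
  "F_fun c \<longleftrightarrow> (\<forall>g\<in>carrier G. c g \<in> F) \<and> class_fun G c \<and>
     (\<forall>mu. mat_eigenvalue (carrier G) (cayley_mat G c) mu \<longrightarrow> mu \<in> F)"
  unfolding F_fun_def
  using eigenvalues_in_F_imp_pow_invariant[of c] pow_invariant_imp_eigenvalues_in_F[of c] by blast

text \<open>Power maps do not respect convolution, so invariance is not checked directly. It is
  translated into eigenvalues, which are squared, and translated back.\<close>

lemma F_fun_conv_self:
  assumes "F_fun c"
  shows "F_fun (conv G c c)"
  unfolding F_fun_iff_eigenvalues
proof (intro conjI allI impI ballI)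
  fix g assume "g \<in> carrier G"
  then show "conv G c c g \<in> F" using assms
    unfolding conv_def F_fun_def by (intro subfield_sum[OF F] subfield_mult[OF F]) auto
next
  show "class_fun G (conv G c c)" using assms by (simp add: F_fun_def class_fun_conv)
next
  fix mu assume "mat_eigenvalue (carrier G) (cayley_mat G (conv G c c)) mu"
  then obtain s where "s * s = mu" "mat_eigenvalue (carrier G) (cayley_mat G c) s"
    using mat_eigenvalue_square by (metis mat_mult_cayley)
  then show "mu \<in> F" using assms subfield_mult[OF F, of s s] by (simp add: F_fun_iff_eigenvalues)
qed

lemma F_fun_add: "F_fun c \<Longrightarrow> F_fun d \<Longrightarrow> F_fun (\<lambda>g. c g + d g)"
  using F by (auto simp: F_fun_def class_fun_def intro: subfield_add)

lemma F_fun_diff: "F_fun c \<Longrightarrow> F_fun d \<Longrightarrow> F_fun (\<lambda>g. c g - d g)"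
  using F by (auto simp: F_fun_def class_fun_def intro: subfield_diff)

text \<open>Polarisation reduces products to squares, whose eigenvalues are the squares of eigenvalues.\<close>

lemma F_fun_conv:
  assumes c: "F_fun c" and d: "F_fun d"
  shows "F_fun (conv G c d)"
proof -
  let ?p = "conv G (\<lambda>g. c g + d g) (\<lambda>g. c g + d g)"
  let ?q = "conv G (\<lambda>g. c g - d g) (\<lambda>g. c g - d g)"
  have pq: "F_fun (\<lambda>g. ?p g - ?q g)"
    using c d by (intro F_fun_diff F_fun_conv_self F_fun_add)
  \<comment> \<open>The difference of squares is \<open>2 (c d + d c)\<close>; both products agree
    because \<open>c\<close> is a class function.\<close>
  have eq: "?p g - ?q g = 4 * conv G c d g" if g: "g \<in> carrier G" for g
  proof -
    have "?p g - ?q g = 2 * conv G c d g + 2 * conv G d c g"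
      unfolding conv_def sum_subtractf[symmetric] sum_distrib_left sum.distrib[symmetric]
      by (intro sum.cong refl) (simp add: algebra_simps)
    also have "conv G d c g = conv G c d g"
      using conv_commute[of c g d] c g by (simp add: F_fun_def)
    finally show ?thesis by simp
  qed
  have "conv G c d g \<in> F" if g: "g \<in> carrier G" for g
    using that c d unfolding conv_def F_fun_def
    by (intro subfield_sum[OF F] subfield_mult[OF F]) auto
  moreover have "class_fun G (conv G c d)" using c d by (simp add: F_fun_def class_fun_conv)
  moreover have "conv G c d (g [^] k) = conv G c d g" if "k \<in> ZF G F" "g \<in> carrier G" for k g
  proof -
    have "?p (g [^] k) - ?q (g [^] k) = ?p g - ?q g" using pq that by (simp add: F_fun_def)
    then show ?thesis using eq that by simp
  qed
  ultimately show ?thesis by (simp add: F_fun_def)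
qed

lemma F_fun_indicator_iff:
  assumes "C \<subseteq> carrier G"
  shows "F_fun (\<lambda>g. if g \<in> C then 1 else 0) \<longleftrightarrow> (\<exists>Q\<subseteq>simF_classes G F. C = \<Union>Q)"
proof -
  let ?c = "\<lambda>g. if g \<in> C then 1 else 0 :: complex"
  have "F_fun ?c \<longleftrightarrow> (\<forall>D\<in>simF_classes G F. \<forall>g\<in>D. \<forall>h\<in>D. ?c g = ?c h)"
    unfolding const_on_simF_classes_iff F_fun_def using subfield_0[OF F] subfield_1[OF F] by simp
  also have "\<dots> \<longleftrightarrow> (\<forall>D\<in>simF_classes G F. \<forall>g\<in>D. \<forall>h\<in>D. g \<in> C \<longleftrightarrow> h \<in> C)"
    by (intro ball_cong refl) auto
  also have "\<dots> \<longleftrightarrow> (\<exists>Q\<subseteq>simF_classes G F. C = \<Union>Q)"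
    using union_of_blocks_iff[OF partition_simF_classes assms] by simp
  finally show ?thesis .
qed

lemma class_fun_indicator:
  assumes "C \<subseteq> carrier G" "\<exists>Q\<subseteq>conj_classes G. C = \<Union>Q"
  shows "class_fun G (\<lambda>g. if g \<in> C then 1 else 0)"
proof -
  have *: "\<forall>D\<in>conj_classes G. \<forall>g\<in>D. \<forall>h\<in>D. g \<in> C \<longleftrightarrow> h \<in> C"
    using assms(2) unfolding union_of_blocks_iff[OF partition_conj_classes assms(1)] .
  show ?thesis unfolding const_on_conj_classes_iff[symmetric]
  proof (intro ballI)
    fix D g h assume "D \<in> conj_classes G" "g \<in> D" "h \<in> D"
    then have "g \<in> C \<longleftrightarrow> h \<in> C" using * by blast
    then show "(if g \<in> C then 1 else 0 :: complex) = (if h \<in> C then 1 else 0)" by simp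
  qed
qed

section \<open>The matrices \<open>B_mats\<close> as a subscheme\<close>

lemma simF_class_one: "simF_class G F \<one> = {\<one>}"
proof -
  have "h = \<one>" if "simF G F h \<one>" for h
    using that by (auto elim!: simF_E)
  then show ?thesis using simF_refl by (auto simp: simF_class_def)
qed

lemma simF_inv:
  assumes "simF G F g h"
  shows "simF G F (inv g) (inv h)"
proof -
  obtain x k where xk: "g \<in> carrier G" "h \<in> carrier G" "x \<in> carrier G" "k \<in> ZF G F"
    "g = x \<otimes> h [^] k \<otimes> inv x" using assms by (rule simF_E)
  have "inv g = x \<otimes> inv h [^] k \<otimes> inv x"
    using xk by (simp add: inv_mult_group m_assoc nat_pow_inv)
  then show ?thesis using simF_I[of x "inv h" k] xk by simp
qed

lemma simF_class_in: "g \<in> carrier G \<Longrightarrow> simF_class G F g \<in> simF_classes G F"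
  by (simp add: simF_classes_def)

text \<open>Transposition exchanges \<open>b a^-1\<close> with its inverse \<open>a b^-1\<close>,
  and inversion maps \<open>simF\<close> classes to \<open>simF\<close> classes.\<close>

lemma transp_set_mat_simF_class:
  assumes g: "g \<in> carrier G"
  shows "transp_mat (set_mat G (simF_class G F g)) = set_mat G (simF_class G F (inv g))"
proof (intro ext)
  fix a b
  have iff: "simF G F (a \<otimes> inv b) g \<longleftrightarrow> simF G F (b \<otimes> inv a) (inv g)"
    if "a \<in> carrier G" "b \<in> carrier G"
  proof -
    have "inv (a \<otimes> inv b) = b \<otimes> inv a" "inv (b \<otimes> inv a) = a \<otimes> inv b"
      using that by (simp_all add: inv_mult_group)
    then show ?thesis using simF_inv[of "a \<otimes> inv b" g] simF_inv[of "b \<otimes> inv a" "inv g"] g by auto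
  qed
  have sub: "simF_class G F h \<subseteq> carrier G" for h by (auto simp: simF_class_def)
  show "transp_mat (set_mat G (simF_class G F g)) a b = set_mat G (simF_class G F (inv g)) a b"
    unfolding transp_mat_def set_mat_eq_cayley[OF sub] cayley_mat_def
    using iff by (auto simp: simF_class_def)
qed

text \<open>Indicators of classes satisfy \<open>F_fun\<close>. Closure of the span under products
  is thus \<open>F_fun_conv\<close>, and commutativity holds because class functions are
  central.\<close>

lemma is_assoc_scheme_B_mats: "is_assoc_scheme (carrier G) (B_mats G F)"
proof -
  note P = partition_on_carrier[OF partition_simF_classes]
  have F_fun_D: "F_fun (\<lambda>g. if g \<in> D then 1 else 0)" if "D \<in> simF_classes G F" for D
    unfolding F_fun_indicator_iff[OF P(2)[OF that]] using that by (intro exI[of _ "{D}"]) auto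
  have mat: "\<exists>c. M = cayley_mat G c \<and> F_fun c" if M: "M \<in> B_mats G F" for M
    using M F_fun_D set_mat_eq_cayley[OF P(2)] unfolding B_mats_def by blast
  have "\<forall>M\<in>B_mats G F. \<forall>a b. M a b \<in> {0, 1}"
    unfolding B_mats_def using P(2) by (auto simp: set_mat_eq_cayley cayley_mat_def)
  moreover have "\<forall>M\<in>B_mats G F. \<forall>a b. a \<notin> carrier G \<or> b \<notin> carrier G \<longrightarrow> M a b = 0"
    unfolding B_mats_def using P(2) by (auto simp: set_mat_eq_cayley cayley_mat_def)
  moreover have "\<forall>M\<in>B_mats G F. \<exists>a\<in>carrier G. \<exists>b\<in>carrier G. M a b \<noteq> 0"
  proof
    fix M assume "M \<in> B_mats G F"
    then obtain D where D: "D \<in> simF_classes G F" "M = set_mat G D" unfolding B_mats_def by blast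
    obtain g where g: "g \<in> D" using partition_simF_classes D(1) by (metis partition_on_def all_not_in_conv)
    then have "M \<one> g \<noteq> 0" using D P(2)[OF D(1)] by (auto simp: set_mat_eq_cayley cayley_mat_def)
    then show "\<exists>a\<in>carrier G. \<exists>b\<in>carrier G. M a b \<noteq> 0" using g P(2)[OF D(1)] by blast
  qed
  moreover have "id_mat (carrier G) \<in> B_mats G F"
  proof -
    have "id_mat (carrier G) = set_mat G (simF_class G F \<one>)"
      by (simp add: id_mat_eq_perm simF_class_one set_mat_def)
    then show ?thesis unfolding B_mats_def using simF_class_in by simp
  qed
  moreover have "\<forall>a\<in>carrier G. \<forall>b\<in>carrier G. (\<Sum>M\<in>B_mats G F. M a b) = 1"
  proof (intro ballI)
    fix a b assume ab: "a \<in> carrier G" "b \<in> carrier G"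
    have "(\<lambda>a b. \<Sum>X\<in>B_mats G F. 1 * X a b) = cayley_mat G (\<lambda>_. 1)"
      unfolding B_mats_def by (rule sum_set_mats[OF partition_simF_classes]) simp
    then have "(\<Sum>X\<in>B_mats G F. 1 * X a b) = cayley_mat G (\<lambda>_. 1) a b" by (rule fun_cong[OF fun_cong])
    then show "(\<Sum>M\<in>B_mats G F. M a b) = 1" using ab by (simp add: cayley_mat_def)
  qed
  moreover have "\<forall>M\<in>B_mats G F. transp_mat M \<in> B_mats G F"
    unfolding B_mats_def simF_classes_def by (auto simp: transp_set_mat_simF_class)
  moreover have "\<forall>M\<in>B_mats G F. \<forall>N\<in>B_mats G F. mat_mult (carrier G) M N \<in> span_over UNIV (B_mats G F)"
  proof (intro ballI)
    fix M N assume "M \<in> B_mats G F" "N \<in> B_mats G F"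
    then obtain c d where "M = cayley_mat G c" "F_fun c" "N = cayley_mat G d" "F_fun d"
      using mat by metis
    then show "mat_mult (carrier G) M N \<in> span_over UNIV (B_mats G F)"
      using F_fun_conv[of c d] unfolding span_B_mats F_fun_def by (auto simp: mat_mult_cayley)
  qed
  moreover have "\<forall>M\<in>B_mats G F. \<forall>N\<in>B_mats G F. mat_mult (carrier G) M N = mat_mult (carrier G) N M"
    using mat cayley_mat_commute unfolding F_fun_def by metis
  moreover have "finite (B_mats G F)" unfolding B_mats_def using P(1) by simp
  ultimately show ?thesis unfolding is_assoc_scheme_def by simp
qed

lemma conj_class_subset_simF_class:
  assumes "D \<in> simF_classes G F" "g \<in> D"
  shows "conj_class G g \<subseteq> D"
proof
  note P = partition_on_carrier[OF partition_simF_classes]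
  fix h assume "h \<in> conj_class G g"
  then obtain x where x: "x \<in> carrier G" "h = x \<otimes> g \<otimes> inv x" by (auto simp: conj_class_def)
  have g: "g \<in> carrier G" using assms P(2) by blast
  have "simF G F h g"
    using simF_I[OF x(1) g ZF_one] x g pow_mod_exponent[OF g, of 1] by simp
  then have "h \<in> simF_class G F g" "g \<in> simF_class G F g"
    using x g simF_refl by (auto simp: simF_class_def)
  then show "h \<in> D" using P(4)[OF assms(1) simF_class_in[OF g] assms(2)] by simp
qed

lemma is_subscheme_B_mats: "is_subscheme (carrier G) (class_scheme G) (B_mats G F)"
  unfolding is_subscheme_def
proof (intro conjI is_assoc_scheme_B_mats exI)
  note P = partition_on_carrier[OF partition_simF_classes]
    and K = partition_on_carrier[OF partition_conj_classes]
  \<comment> \<open>The conjugacy classes are grouped by the \<open>simF\<close> class containing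
    them; \<open>set_mat\<close>, injective on blocks, carries this grouping over to the
    matrices.\<close>
  define Q where "Q D = {C \<in> conj_classes G. C \<subseteq> D}" for D
  have self: "g \<in> conj_class G g" if "g \<in> carrier G" for g
    unfolding conj_class_def using that by (intro CollectI exI[of _ \<one>]) simp
  have UQ: "\<Union>(Q D) = D" if D: "D \<in> simF_classes G F" for D
  proof (intro equalityI subsetI)
    fix g assume g: "g \<in> D"
    then have "g \<in> carrier G" using P(2)[OF D] by blast
    then show "g \<in> \<Union>(Q D)"
      using self conj_class_subset_simF_class[OF D g] by (auto simp: Q_def conj_classes_def)
  qed (auto simp: Q_def)
  have Pne: "D \<noteq> {}" if "D \<in> simF_classes G F" for D
    using partition_simF_classes that by (auto simp: partition_on_def)
  have Kne: "C \<noteq> {}" if "C \<in> conj_classes G" for C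
    using partition_conj_classes that by (auto simp: partition_on_def)
  have part: "partition_on (conj_classes G) (Q ` simF_classes G F)"
  proof (rule partition_onI)
    show "\<Union>(Q ` simF_classes G F) = conj_classes G"
    proof (intro equalityI subsetI)
      fix C assume C: "C \<in> conj_classes G"
      then obtain g where g: "g \<in> carrier G" "C = conj_class G g" by (auto simp: conj_classes_def)
      then obtain D where "D \<in> simF_classes G F" "g \<in> D" using P(3) by blast
      then show "C \<in> \<Union>(Q ` simF_classes G F)"
        using conj_class_subset_simF_class C g by (auto simp: Q_def)
    qed (auto simp: Q_def)
  next
    fix p q assume "p \<in> Q ` simF_classes G F" "q \<in> Q ` simF_classes G F" "p \<noteq> q"
    then obtain D E where DE: "D \<in> simF_classes G F" "E \<in> simF_classes G F" "p = Q D" "q = Q E" "D \<noteq> E"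
      by blast
    have False if "C \<in> p" "C \<in> q" for C
    proof -
      have C: "C \<in> conj_classes G" "C \<subseteq> D" "C \<subseteq> E" using that DE by (auto simp: Q_def)
      then obtain g where "g \<in> D" "g \<in> E" using Kne by blast
      then show False using P(4) DE by blast
    qed
    then show "disjnt p q" by (auto simp: disjnt_def)
  next
    show "{} \<notin> Q ` simF_classes G F" using UQ Pne by force
  qed
  \<comment> \<open>The image of a partition is only a partition after removing an empty block; here
    no block is empty.\<close>
  have "(`) (set_mat G) ` Q ` simF_classes G F - {{}} = (`) (set_mat G) ` Q ` simF_classes G F"
    using part by (auto simp: partition_on_def)
  then show "partition_on (class_scheme G) ((`) (set_mat G) ` Q ` simF_classes G F)"
    unfolding class_scheme_def using partition_on_inj_image[OF part K(5)] by simp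
  have sum: "(\<lambda>a b. \<Sum>M\<in>set_mat G ` Q D. M a b) = set_mat G D" if D: "D \<in> simF_classes G F" for D
  proof (intro ext)
    fix a b
    have "inj_on (set_mat G) (Q D)" using K(5) by (rule inj_on_subset) (auto simp: Q_def)
    then have "(\<Sum>M\<in>set_mat G ` Q D. M a b) = (\<Sum>C\<in>Q D. \<Sum>g\<in>C. perm_mat G g a b)"
      by (simp only: sum.reindex o_def) (simp add: set_mat_def)
    also have "\<dots> = (\<Sum>g\<in>\<Union>(Q D). perm_mat G g a b)"
    proof -
      have "\<forall>C\<in>Q D. finite C" using K(2) finite_subset[OF _ finite_carrier] by (auto simp: Q_def)
      moreover have "\<forall>A\<in>Q D. \<forall>B\<in>Q D. A \<noteq> B \<longrightarrow> A \<inter> B = {}" using K(4) by (auto simp: Q_def)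
      ultimately show ?thesis by (simp add: sum.Union_disjoint)
    qed
    finally show "(\<Sum>M\<in>set_mat G ` Q D. M a b) = set_mat G D a b" by (simp add: UQ[OF D] set_mat_def)
  qed
  show "B_mats G F = (\<lambda>\<beta> a b. \<Sum>M\<in>\<beta>. M a b) ` (`) (set_mat G) ` Q ` simF_classes G F"
    unfolding B_mats_def image_image using sum by (intro image_cong refl) simp
qed

end

theorem theorem9p1:
  fixes G :: "('a, 'b) monoid_scheme" and F :: "complex set"
  assumes "group G" and "finite (carrier G)"
    and "is_subfield F" and "F \<subseteq> cyclo_field (group_exponent G)"
  shows "{M \<in> span_over (cyclo_field (group_exponent G)) (class_scheme G).
            (\<forall>a\<in>carrier G. \<forall>b\<in>carrier G. M a b \<in> F)
          \<and> (\<forall>mu. mat_eigenvalue (carrier G) M mu \<longrightarrow> mu \<in> F)}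
         = span_over F (B_mats G F)
    \<and> is_subscheme (carrier G) (class_scheme G) (B_mats G F)
    \<and> (\<forall>C. C \<subseteq> carrier G \<and> (\<exists>Q \<subseteq> conj_classes G. C = \<Union>Q) \<longrightarrow>
           ((\<forall>mu. mat_eigenvalue (carrier G) (set_mat G C) mu \<longrightarrow> mu \<in> F)
            \<longleftrightarrow> (\<exists>Q \<subseteq> simF_classes G F. C = \<Union>Q)))"
proof -
  interpret group G by fact
  interpret galois_group G F
    using assms by unfold_locales
  have entries: "(\<forall>a\<in>carrier G. \<forall>b\<in>carrier G. cayley_mat G c a b \<in> F) \<longleftrightarrow> (\<forall>g\<in>carrier G. c g \<in> F)" for c
  proof (intro iffI ballI)
    fix g assume "\<forall>a\<in>carrier G. \<forall>b\<in>carrier G. cayley_mat G c a b \<in> F" "g \<in> carrier G"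
    then have "cayley_mat G c \<one>\<^bsub>G\<^esub> g \<in> F" by blast
    then show "c g \<in> F" using \<open>g \<in> carrier G\<close> by (simp add: cayley_mat_def)
  qed (auto simp: cayley_mat_def)
  \<comment> \<open>Entries and coefficients are the same numbers, and
    \<open>F \<subseteq> L\<close> turns coefficients in \<open>F\<close> into coefficients
    admissible for the span over \<open>L\<close>.\<close>
  have "{M \<in> span_over (cyclo_field (group_exponent G)) (class_scheme G).
            (\<forall>a\<in>carrier G. \<forall>b\<in>carrier G. M a b \<in> F)
          \<and> (\<forall>mu. mat_eigenvalue (carrier G) M mu \<longrightarrow> mu \<in> F)}
      = {cayley_mat G c | c. F_fun c}"
    unfolding span_class_scheme F_fun_iff_eigenvalues using entries F_subset by blast
  \<comment> \<open>The indicator of \<open>C\<close> has values 0 and 1 in \<open>F\<close> and is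
    a class function, so of the criterion for \<open>F_fun\<close> only the eigenvalue condition
    remains.\<close>
  moreover have "(\<forall>mu. mat_eigenvalue (carrier G) (set_mat G C) mu \<longrightarrow> mu \<in> F)
            \<longleftrightarrow> (\<exists>Q \<subseteq> simF_classes G F. C = \<Union>Q)"
    if "C \<subseteq> carrier G" "\<exists>Q \<subseteq> conj_classes G. C = \<Union>Q" for C
    unfolding F_fun_indicator_iff[OF that(1), symmetric] F_fun_iff_eigenvalues
    using class_fun_indicator[OF that] set_mat_eq_cayley[OF that(1)] subfield_0[OF F] subfield_1[OF F]
    by simp
  ultimately show ?thesis using span_F_B_mats is_subscheme_B_mats by simp
qed

end
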